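(* Let $m$ be an odd positive integer and let $2^s\geq 4$. Suppose the symmetric vector $(a_0,a_1,\ldots,a_{2^s-1})\in\mathbb{F}_2^{2^s}$ satisfies $a_0=1$, $a_{2^{s-1}}=0$ and $\sum_{0\leq i\leq 2^{s-1}-1,\ i\text{ odd}}a_i=1$, and the symmetric vector $(b_0,b_1,\ldots,b_{m-1})\in\mathbb{F}_2^m$ satisfies $\gcd\left(\sum_{0\leq i\leq m-1}b_ix^i,\ x^m-1\right)=1$ in $\mathbb{F}_2[x]$. Then there exists a normal element of $\mathbb{F}_{2^{2^sm}}$ over $\mathbb{F}_2$ with corresponding vector $(c_0,c_1,\ldots,c_{2^sm-1})\in\mathbb{F}_2^{2^sm}$ such that $c_k=a_{k\ (\mathrm{mod}\ 2^s)}\,b_{k\ (\mathrm{mod}\ m)}$ for $0\leq k\leq 2^sm-1$.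
   Context: For a positive integer $N$, an element $\alpha\in\mathbb{F}_{2^N}$ is a normal element of $\mathbb{F}_{2^N}$ over $\mathbb{F}_2$ if $\{\alpha,\alpha^2,\alpha^{2^2},\ldots,\alpha^{2^{N-1}}\}$ is a basis of $\mathbb{F}_{2^N}$ over $\mathbb{F}_2$. The trace function is $\mathrm{Tr}_{2^N|2}(x)=\sum_{i=0}^{N-1}x^{2^i}$. The corresponding vector of $\alpha\in\mathbb{F}_{2^N}$ is $(c_0,\ldots,c_{N-1})\in\mathbb{F}_2^N$ with $c_i=\mathrm{Tr}_{2^N|2}(\alpha\cdot\alpha^{2^i})$ for $0\leq i\leq N-1$. A vector $(a_0,\ldots,a_{N-1})$ is symmetric if $a_i=a_{N-i}$ for all $1\leq i\leq N-1$. Subscripts $k\ (\mathrm{mod}\ 2^s)$ and $k\ (\mathrm{mod}\ m)$ denote least nonnegative residues. *)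

theory Defs
  imports "Berlekamp_Zassenhaus.Finite_Field"
begin

text \<open>The field with two elements is \<open>bool mod_ring\<close>: the integers modulo
  \<open>CARD(bool) = 2\<close>.\<close>

instance bool :: prime_card
  by standard simp

type_synonym gf2 = "bool mod_ring"

text \<open>The inclusion of the field with two elements into an extension field. It is a ring
  homomorphism only in characteristic 2, which is the case in every field with \<open>2 ^ N\<close> elements,
  \<open>N > 0\<close>.\<close>

definition gf2_embed :: "gf2 \<Rightarrow> 'a::ring_1" where
  "gf2_embed c = of_int (to_int_mod_ring c)"

definition gf2_scale :: "gf2 \<Rightarrow> 'a::ring_1 \<Rightarrow> 'a" where
  "gf2_scale c x = gf2_embed c * x"

lemma gf2_cases: "c = 0 \<or> c = (1::gf2)"
proof -
  have "(UNIV :: gf2 set) = {0, 1}"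
    by (rule sym, rule card_subset_eq) simp_all
  then show ?thesis by blast
qed

lemma gf2_embed_0 [simp]: "gf2_embed 0 = 0" and gf2_embed_1 [simp]: "gf2_embed 1 = 1"
  by (simp_all add: gf2_embed_def)

lemma gf2_one_plus_one: "1 + 1 = (0::gf2)"
  by transfer simp

lemma vector_space_gf2_scale:
  assumes "CARD('a::{field,finite}) = 2 ^ N" "N > 0"
  shows "vector_space (gf2_scale :: gf2 \<Rightarrow> 'a \<Rightarrow> 'a)"
proof -
  have "CHAR('a) dvd 2 ^ N"
    using CHAR_dvd_CARD[where 'a = 'a] assms by simp
  moreover have "prime CHAR('a)"
    by (rule prime_CHAR_semidom) (use finite_imp_CHAR_pos[where 'a = 'a] in simp)
  ultimately have "CHAR('a) = 2"
    by (metis primes_dvd_imp_eq prime_dvd_power two_is_prime_nat)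
  then have two: "1 + 1 = (0::'a)"
    using of_nat_CHAR[where 'a = 'a] by (simp add: one_add_one)
  have add: "gf2_embed (c + d) = gf2_embed c + (gf2_embed d :: 'a)" for c d
    using gf2_cases[of c] gf2_cases[of d] two gf2_one_plus_one by (elim disjE) (simp_all del: one_add_one)
  have mult: "gf2_embed (c * d) = gf2_embed c * (gf2_embed d :: 'a)" for c d
    using gf2_cases[of c] gf2_cases[of d] by (elim disjE) simp_all
  show ?thesis
    by unfold_locales (simp_all add: gf2_scale_def add mult algebra_simps)
qed

definition normal_element :: "nat \<Rightarrow> 'a::field \<Rightarrow> bool" where
  "normal_element N \<alpha> \<longleftrightarrow>
     (let B = {\<alpha> ^ (2 ^ i) | i. i < N}
      in \<not> module.dependent gf2_scale B \<and> module.span gf2_scale B = UNIV)"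

definition field_trace :: "nat \<Rightarrow> 'a::field \<Rightarrow> 'a" where
  "field_trace N x = (\<Sum>i<N. x ^ (2 ^ i))"

text \<open>Vectors of length \<open>n\<close> are functions on \<open>nat\<close> of which only the values below \<open>n\<close> matter.
  The trace takes values in the prime field, which is identified with \<^typ>\<open>gf2\<close> via
  \<^const>\<open>gf2_embed\<close>; hence the relational form.\<close>

definition corresponding_vector :: "nat \<Rightarrow> 'a::field \<Rightarrow> (nat \<Rightarrow> gf2) \<Rightarrow> bool" where
  "corresponding_vector N \<alpha> c \<longleftrightarrow> (\<forall>i<N. gf2_embed (c i) = field_trace N (\<alpha> * \<alpha> ^ (2 ^ i)))"

definition symmetric_vector :: "nat \<Rightarrow> (nat \<Rightarrow> gf2) \<Rightarrow> bool" where
  "symmetric_vector n a \<longleftrightarrow> (\<forall>i. 1 \<le> i \<and> i \<le> n - 1 \<longrightarrow> a i = a (n - i))"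

end

theory Submission
  imports Defs "HOL-Number_Theory.Cong"
begin

text \<open>
  Let \<open>n = 2 ^ s\<close>. If \<open>u\<close> and \<open>v\<close> lie in the subfields with \<open>2 ^ n\<close> and \<open>2 ^ m\<close> elements and have
  corresponding vectors \<open>a\<close> and \<open>b\<close>, then \<open>u * v\<close> has the required vector because \<open>n\<close> and \<open>m\<close> are
  coprime, and it is normal because its vector is invertible in the group algebra
  \<open>GF(2)[x] / (x ^ (n * m) - 1)\<close>. Replacing \<open>u\<close> by its image under \<open>f\<close> in the group algebra, with
  \<open>x\<close> acting as the Frobenius map, multiplies the vector by \<open>f * star f\<close>, where \<open>star\<close> is the
  involution \<open>x \<mapsto> x ^ (- 1)\<close>. So for each factor it remains to start from some element and to
  recognise a quotient of two vectors as a norm \<open>f * star f\<close>.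

  For odd \<open>m\<close> squaring is bijective on the group algebra, and a symmetric unit \<open>V * V\<close> with
  symmetric \<open>V\<close> is the norm of \<open>V\<close>. For \<open>n = 2 ^ s\<close> the norms of units are exactly the elements
  \<open>1 + W + star W\<close> that are congruent to \<open>1\<close> modulo \<open>x ^ 4 - 1\<close>; this is shown by induction
  on \<open>s\<close>, lifting along \<open>x ^ (n / 2) - 1\<close>. The vector of an element of trace one has the form
  \<open>1 + W + star W\<close> too, but is congruent to \<open>1 + x + x ^ 3\<close> modulo \<open>x ^ 4 - 1\<close>, which is what
  the hypothesis on the entries of \<open>a\<close> with odd index says.
\<close>

subsection \<open>Polynomials modulo $x^n - 1$\<close>

abbreviation (input) xp :: "nat \<Rightarrow> gf2 poly" where
  "xp k \<equiv> monom 1 k"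

definition cyc :: "nat \<Rightarrow> gf2 poly" where
  "cyc n = xp n - 1"

text \<open>Modulo \<open>cyc n\<close> the exponent \<open>n - 1\<close> stands for
  \<open>-1\<close>, which keeps the inverse of \<open>x\<close> inside the polynomials.\<close>

definition star :: "nat \<Rightarrow> gf2 poly \<Rightarrow> gf2 poly" where
  "star n f = f \<circ>\<^sub>p xp (n - 1)"

text \<open>The identity coefficient in the group algebra of the cyclic group of order
  \<open>n\<close>; \<open>tau n (f * g)\<close> is the standard nondegenerate bilinear form
  there.\<close>

definition tau :: "nat \<Rightarrow> gf2 poly \<Rightarrow> gf2" where
  "tau n f = coeff (f mod cyc n) 0"

lemma gf2_two [simp]: "(2::gf2) = 0"
  using gf2_one_plus_one by simp

lemma gf2_poly_two [simp]: "(2::gf2 poly) = 0"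
  by (simp add: numeral_poly)

lemma gf2_poly_double: "f + f = (0::gf2 poly)"
  by (simp flip: mult_2)

lemma gf2_poly_uminus [simp]: "- f = (f::gf2 poly)"
  by (rule minus_unique) (rule gf2_poly_double)

lemma gf2_poly_diff: "f - g = f + (g::gf2 poly)"
  using diff_conv_add_uminus[of f g] by simp

lemma xp_add: "xp (i + j) = xp i * xp j"
  by (simp add: mult_monom)

lemma xp_power: "xp i ^ j = xp (i * j)"
  by (simp add: monom_power)

text \<open>Coefficients are 0 or 1, so every polynomial is a sum of powers of \<open>x\<close>, and
  additive statements need only be checked on those.\<close>

lemma gf2_poly_induct [case_names zero xp add]:
  assumes "P 0" and "\<And>k. P (xp k)" and "\<And>f g. P f \<Longrightarrow> P g \<Longrightarrow> P (f + g)"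
  shows "P f"
proof -
  have *: "P (monom c k)" for c k
    using gf2_cases[of c] assms(1,2) by auto
  have "P (\<Sum>i\<in>A. monom (coeff f i) i)" if "finite A" for A
    using that by induction (use assms * in auto)
  from this[of "{..degree f}"] show ?thesis
    by (simp add: poly_as_sum_of_monoms)
qed

lemma xp_pcompose: "xp k \<circ>\<^sub>p q = q ^ k"
  by (induction k) (simp_all add: monom_Suc pcompose_pCons one_pCons)

lemma pcompose_xp: "xp k \<circ>\<^sub>p xp d = xp (k * d)"
  by (simp add: xp_pcompose xp_power mult.commute)

lemma pcompose_xp_xp: "(f \<circ>\<^sub>p xp i) \<circ>\<^sub>p xp j = f \<circ>\<^sub>p xp (i * j)"
  by (simp add: pcompose_xp flip: pcompose_assoc)

lemma cong_pcompose:
  fixes p q r f :: "gf2 poly"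
  assumes "[p = q] (mod r)"
  shows "[f \<circ>\<^sub>p p = f \<circ>\<^sub>p q] (mod r)"
  using assms by (induction f) (simp_all add: pcompose_pCons cong_add cong_mult)

lemma cyc_nonzero: "n > 0 \<Longrightarrow> cyc n \<noteq> 0"
  by (metis (no_types, lifting) cyc_def degree_1 degree_monom_eq eq_iff_diff_eq_0 less_numeral_extra(3) one_neq_zero)

lemma degree_cyc: "n > 0 \<Longrightarrow> degree (cyc n) = n"
  unfolding cyc_def diff_conv_add_uminus by (subst degree_add_eq_left) (auto simp: degree_monom_eq)

lemma cyc_mult: "cyc (d * k) = cyc d * (\<Sum>j<k. xp (d * j))"
  by (simp add: cyc_def xp_power power_diff_1_eq flip: xp_power)

lemma cyc_dvd: "d dvd n \<Longrightarrow> cyc d dvd cyc n"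
  by (auto simp: cyc_mult)

lemma xp_cong_1: "n dvd k \<Longrightarrow> [xp k = 1] (mod cyc n)"
  using cyc_dvd by (simp add: cong_iff_dvd_diff cyc_def)

lemma xp_cong:
  assumes "[i = j] (mod n)"
  shows "[xp i = xp j] (mod cyc n)"
proof -
  have *: "[xp (a + n * b) = xp a] (mod cyc n)" for a b
    using cong_scalar_left[OF xp_cong_1[of n "n * b"], of "xp a"] by (simp add: xp_add)
  obtain k1 k2 where "j + k1 * n = i + k2 * n"
    using assms cong_iff_lin_nat by blast
  with *[of i k2] *[of j k1] show ?thesis
    by (metis cong_sym cong_trans mult.commute)
qed

text \<open>Substituting \<open>xp d\<close> turns \<open>cyc n\<close> into
  \<open>cyc (n * d)\<close>, a multiple of \<open>cyc e\<close>.\<close>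

lemma cong_pcompose_xp:
  assumes "[f = g] (mod cyc n)" "e dvd n * d"
  shows "[f \<circ>\<^sub>p xp d = g \<circ>\<^sub>p xp d] (mod cyc e)"
proof -
  have "cyc n dvd f - g"
    using assms(1) by (simp add: cong_iff_dvd_diff)
  then obtain h where h: "f - g = cyc n * h" ..
  have "f \<circ>\<^sub>p xp d - g \<circ>\<^sub>p xp d = (f - g) \<circ>\<^sub>p xp d"
    by (simp add: pcompose_diff)
  also have "\<dots> = cyc (n * d) * (h \<circ>\<^sub>p xp d)"
    by (simp only: h pcompose_mult) (simp add: cyc_def pcompose_diff pcompose_xp pcompose_1)
  finally show ?thesis
    using cyc_dvd[OF assms(2)] by (simp add: cong_iff_dvd_diff)
qed

lemma square_eq_pcompose: "(f::gf2 poly)\<^sup>2 = f \<circ>\<^sub>p xp 2"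
proof (induction f rule: gf2_poly_induct)
  case (add f g)
  then show ?case
    by (simp add: power2_sum pcompose_add)
qed (simp_all add: pcompose_xp xp_power)

lemma power_eq_pcompose: "(f::gf2 poly) ^ (2 ^ k) = f \<circ>\<^sub>p xp (2 ^ k)"
proof (induction k)
  case 0
  have "xp 1 = [:0, 1:]"
    by (simp add: monom_Suc one_pCons)
  then show ?case
    by simp
next
  case (Suc k)
  have "f ^ (2 ^ Suc k) = (f ^ (2 ^ k))\<^sup>2"
    by (simp add: power_mult mult.commute flip: power_mult)
  also have "\<dots> = f \<circ>\<^sub>p xp (2 ^ Suc k)"
    by (simp add: Suc square_eq_pcompose pcompose_xp_xp mult.commute)
  finally show ?case .
qed

text \<open>Only the exponents grow under the Frobenius map, and here they all become 0 modulo the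
  group order. So an \<open>f\<close> with \<open>poly f 1 = 1\<close> is a unit with inverse
  \<open>f ^ (2 ^ k - 1)\<close>.\<close>

lemma power_cong_poly_1: "[f ^ (2 ^ k) = [:poly f 1:]] (mod cyc (2 ^ k))"
proof -
  have "[f \<circ>\<^sub>p xp (2 ^ k) = f \<circ>\<^sub>p 1] (mod cyc (2 ^ k))"
    by (intro cong_pcompose xp_cong_1) simp
  moreover have "f \<circ>\<^sub>p 1 = [:poly f 1:]"
    by (simp add: one_pCons pcompose_pCons_0)
  ultimately show ?thesis
    by (simp add: power_eq_pcompose)
qed

lemma poly_1_cong:
  assumes "[f = g] (mod cyc n)"
  shows "poly f 1 = poly g 1"
proof -
  have "cyc n dvd f - g"
    using assms by (simp add: cong_iff_dvd_diff)
  then obtain h where "f - g = cyc n * h" ..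
  then have "poly (f - g) 1 = 0"
    by (simp add: cyc_def poly_monom)
  then show ?thesis
    by simp
qed

section \<open>The involution inverting \<open>x\<close>\<close>

lemma star_0 [simp]: "star n 0 = 0"
  and star_1 [simp]: "star n 1 = 1"
  and star_add: "star n (f + g) = star n f + star n g"
  and star_mult: "star n (f * g) = star n f * star n g"
  and star_xp: "star n (xp k) = xp (k * (n - 1))"
  by (simp_all add: star_def pcompose_1 pcompose_add pcompose_mult pcompose_xp)

lemma poly_1_star [simp]: "poly (star n f) 1 = poly f 1"
  by (simp add: star_def poly_pcompose poly_monom)

lemma star_cong: "[f = g] (mod cyc n) \<Longrightarrow> [star n f = star n g] (mod cyc n)"
  unfolding star_def by (erule cong_pcompose_xp) simp

lemma pred_square_cong: "n > 0 \<Longrightarrow> [(n - 1) * (n - 1) = (1::nat)] (mod n)"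
proof -
  assume "n > 0"
  then obtain k where "n = Suc k"
    using gr0_implies_Suc by blast
  moreover have "k * k + Suc k = 1 + k * Suc k"
    by simp
  ultimately show ?thesis
    unfolding cong_iff_lin_nat by (metis diff_Suc_1 mult_1)
qed

lemma star_star:
  assumes "n > 0"
  shows "[star n (star n f) = f] (mod cyc n)"
proof -
  have "[f \<circ>\<^sub>p xp ((n - 1) * (n - 1)) = f \<circ>\<^sub>p xp 1] (mod cyc n)"
    by (intro cong_pcompose xp_cong pred_square_cong assms)
  moreover have "xp 1 = [:0, 1:]"
    by (simp add: monom_Suc one_pCons)
  ultimately show ?thesis
    by (simp add: star_def pcompose_xp_xp)
qed

text \<open>Both \<open>n - 1\<close> and \<open>d - 1\<close> represent \<open>-1\<close> modulo
  \<open>d\<close>, so the involution commutes with reduction to a smaller cyclic group.\<close>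

lemma star_cong_dvd:
  assumes "d dvd n" "n > 0"
  shows "[star n f = star d f] (mod cyc d)"
proof -
  have "d > 0"
    using assms by (auto intro: Nat.gr0I)
  have "[n - 1 = d - 1] (mod d)"
  proof -
    obtain k where k: "n = d * k" using assms by auto
    with assms have "k > 0" by (cases k) auto
    then obtain j where "k = Suc j" using gr0_implies_Suc by blast
    then have "n - 1 = (d - 1) + j * d" using \<open>d > 0\<close> k by (simp add: algebra_simps)
    then show ?thesis by (simp add: cong_def)
  qed
  then show ?thesis
    unfolding star_def by (intro cong_pcompose xp_cong)
qed

section \<open>The identity coefficient and its nondegeneracy\<close>

lemma tau_0 [simp]: "tau n 0 = 0"
  and tau_add: "tau n (f + g) = tau n f + tau n g"
  by (simp_all add: tau_def poly_mod_add_left)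

lemma tau_sum: "tau n (\<Sum>i\<in>A. f i) = (\<Sum>i\<in>A. tau n (f i))"
  by (induction A rule: infinite_finite_induct) (simp_all add: tau_add)

lemma tau_smult: "tau n (smult c f) = c * tau n f"
  by (simp add: tau_def mod_smult_left)

lemma tau_cong: "[f = g] (mod cyc n) \<Longrightarrow> tau n f = tau n g"
  by (simp add: tau_def cong_def)

lemma tau_xp:
  assumes "n > 0"
  shows "tau n (xp k) = (if n dvd k then 1 else 0)"
proof -
  have "tau n (xp k) = tau n (xp (k mod n))"
    by (intro tau_cong xp_cong) (simp add: cong_def)
  moreover have "xp (k mod n) mod cyc n = xp (k mod n)"
    using assms by (intro mod_poly_less) (simp add: degree_monom_eq degree_cyc)
  ultimately show ?thesis
    by (simp add: tau_def dvd_eq_mod_eq_0)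
qed

lemma tau_star:
  assumes "n > 0"
  shows "tau n (star n f) = tau n f"
proof (induction f rule: gf2_poly_induct)
  case (xp k)
  have "coprime n (n - 1)"
    using assms coprime_diff_one_right_nat by blast
  then show ?case
    by (simp add: star_xp tau_xp assms coprime_dvd_mult_left_iff)
qed (simp_all add: star_add tau_add)

text \<open>Multiplying by \<open>xp (n - j)\<close>, the inverse of \<open>xp j\<close> modulo
  \<open>cyc n\<close>, moves coefficient \<open>j\<close> to position 0.\<close>

lemma coeff_mod_cyc:
  assumes j: "j < n"
  shows "coeff (f mod cyc n) j = tau n (xp (n - j) * f)"
proof -
  define g where "g = f mod cyc n"
  have n: "n > 0"
    using j by simp
  have deg: "degree g < n \<or> g = 0"
    using degree_mod_less[of "cyc n" f] n by (auto simp: g_def cyc_nonzero degree_cyc)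
  have *: "coeff g i * tau n (xp (n - j) * xp i) = (if i = j then coeff g j else 0)"
    if "i \<le> degree g" for i
  proof (cases "g = 0")
    case False
    with deg that have "i < n" by simp
    have "n dvd n - j + i \<longleftrightarrow> i = j"
    proof
      assume "n dvd n - j + i"
      then obtain q where q: "n - j + i = n * q" ..
      have "n * q > 0" "n * q < n * 2" using q \<open>i < n\<close> j by linarith+
      then have "q = 1" by (cases q) auto
      then show "i = j" using q \<open>i < n\<close> j by simp
    qed (use j in simp)
    then show ?thesis
      by (simp add: tau_xp n mult_monom)
  qed simp
  have "tau n (xp (n - j) * f) = tau n (xp (n - j) * g)"
    by (intro tau_cong cong_scalar_left) (simp add: g_def)
  also have "xp (n - j) * g = (\<Sum>i\<le>degree g. smult (coeff g i) (xp (n - j) * xp i))"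
    by (subst poly_as_sum_of_monoms[of g, symmetric])
      (simp add: sum_distrib_left mult_monom smult_monom)
  also have "tau n \<dots> = (\<Sum>i\<le>degree g. if i = j then coeff g j else 0)"
    using * by (simp add: tau_sum tau_smult)
  also have "\<dots> = coeff g j"
    by (cases "j \<le> degree g") (auto simp: coeff_eq_0)
  finally show ?thesis
    by (simp add: g_def)
qed

lemma cong_sum_coeff_mod:
  assumes "n > 0"
  shows "[f = (\<Sum>k<n. monom (coeff (f mod cyc n) k) k)] (mod cyc n)"
proof -
  define g where "g = f mod cyc n"
  have "degree g \<le> n - 1"
    using degree_mod_less[of "cyc n" f] assms by (auto simp: g_def cyc_nonzero degree_cyc)
  then have "g = (\<Sum>k\<le>n - 1. monom (coeff g k) k)"
    by (simp add: poly_as_sum_of_monoms')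
  also have "{..n - 1} = {..<n}"
    using assms by auto
  finally show ?thesis
    by (metis cong_mod_right cong_refl g_def)
qed

lemma tau_nondegenerate:
  assumes "n > 0" and "\<And>k. tau n (xp k * f) = 0"
  shows "cyc n dvd f"
proof -
  have "[f = 0] (mod cyc n)"
    using cong_sum_coeff_mod[OF assms(1), of f] by (simp add: coeff_mod_cyc assms(2))
  then show ?thesis
    by (simp add: cong_0_iff)
qed

lemma coprime_invertible:
  fixes f g :: "gf2 poly"
  assumes "gcd f g = 1"
  obtains h where "[f * h = 1] (mod g)"
proof -
  obtain a b where "a * f + b * g = 1"
    using bezout_coefficients_fst_snd assms by metis
  then have "f * a - 1 = g * b"
    by (simp add: gf2_poly_diff algebra_simps flip: \<open>a * f + b * g = 1\<close>)
  then show ?thesis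
    using that[of a] by (simp add: cong_iff_dvd_diff)
qed

subsection \<open>Norms in the group algebra of a cyclic 2-group\<close>

text \<open>For even \<open>n > 0\<close> these are the symmetric elements with coefficient 1 at 0
  and 0 at \<open>n div 2\<close>: both exponents are fixed by \<open>star\<close>, so
  \<open>W + star n W\<close> has coefficient 0 there.\<close>

definition hermitian_one :: "nat \<Rightarrow> gf2 poly \<Rightarrow> bool" where
  "hermitian_one n U \<longleftrightarrow> (\<exists>W. [U = 1 + W + star n W] (mod cyc n))"

lemma hermitian_one_star:
  assumes "n > 0" "hermitian_one n U"
  shows "[star n U = U] (mod cyc n)"
proof -
  obtain W where W: "[U = 1 + W + star n W] (mod cyc n)"
    using assms by (auto simp: hermitian_one_def)
  have "[star n U = 1 + star n W + star n (star n W)] (mod cyc n)"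
    using star_cong[OF W] by (simp add: star_add)
  also have "[1 + star n W + star n (star n W) = 1 + star n W + W] (mod cyc n)"
    using assms by (intro cong_add star_star) simp_all
  also have "1 + star n W + W = 1 + W + star n W"
    by (simp add: ac_simps)
  finally show ?thesis
    using W by (metis cong_sym cong_trans)
qed

text \<open>Because \<open>U\<close> is symmetric, \<open>U * W' + U * star n W'\<close> is again an
  element plus its image under \<open>star\<close>.\<close>

lemma hermitian_one_mult:
  assumes "n > 0" "hermitian_one n U" "hermitian_one n V"
  shows "hermitian_one n (U * V)"
proof -
  obtain W W' where W: "[U = 1 + W + star n W] (mod cyc n)"
      and W': "[V = 1 + W' + star n W'] (mod cyc n)"
    using assms by (auto simp: hermitian_one_def)
  have "[U * V = U * (1 + W' + star n W')] (mod cyc n)"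
    by (intro cong_scalar_left W')
  also have "U * (1 + W' + star n W') = U + (U * W' + U * star n W')"
    by (simp add: algebra_simps)
  also have "[\<dots> = (1 + W + star n W) + (U * W' + star n U * star n W')] (mod cyc n)"
    by (intro cong_add W cong_scalar_right cong_refl cong_sym[OF hermitian_one_star] assms)
  also have "(1 + W + star n W) + (U * W' + star n U * star n W') = 1 + (W + U * W') + star n (W + U * W')"
    by (simp add: star_add star_mult algebra_simps)
  finally show ?thesis
    unfolding hermitian_one_def by blast
qed

lemma hermitian_one_1: "hermitian_one n 1"
  unfolding hermitian_one_def by (intro exI[of _ 0]) simp

lemma hermitian_one_power: "n > 0 \<Longrightarrow> hermitian_one n U \<Longrightarrow> hermitian_one n (U ^ k)"
  by (induction k) (simp_all add: hermitian_one_1 hermitian_one_mult)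

lemma hermitian_one_dvd:
  assumes "d dvd n" "n > 0" "hermitian_one n U"
  shows "hermitian_one d U"
proof -
  obtain W where W: "[U = 1 + W + star n W] (mod cyc n)"
    using assms by (auto simp: hermitian_one_def)
  then have "[U = 1 + W + star n W] (mod cyc d)"
    using cong_dvd_modulus cyc_dvd assms(1) by blast
  also have "[1 + W + star n W = 1 + W + star d W] (mod cyc d)"
    by (intro cong_add star_cong_dvd assms) simp_all
  finally show ?thesis
    unfolding hermitian_one_def by blast
qed

lemma hermitian_one_poly_1:
  assumes "hermitian_one n U"
  shows "poly U 1 = 1"
proof -
  obtain W where "[U = 1 + W + star n W] (mod cyc n)"
    using assms by (auto simp: hermitian_one_def)
  from poly_1_cong[OF this] show ?thesis
    by simp
qed

text \<open>Write \<open>f\<close> as a sum of powers of \<open>x\<close>. Each diagonal product is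
  1, and their number modulo 2 is \<open>poly f 1\<close>; the mixed products come in pairs
  exchanged by \<open>star\<close>.\<close>

lemma norm_cong:
  assumes "n > 0"
  shows "\<exists>W. [f * star n f = [:poly f 1:] + W + star n W] (mod cyc n)"
proof (induction f rule: gf2_poly_induct)
  case (xp k)
  have "k + k * (n - 1) = k * n"
    using assms by (cases n) simp_all
  then have "[xp k * star n (xp k) = 1] (mod cyc n)"
    by (simp add: star_xp mult_monom xp_cong_1)
  then show ?case
    by (intro exI[of _ 0]) (simp add: poly_monom one_pCons)
next
  case (add f g)
  then obtain V W where V: "[f * star n f = [:poly f 1:] + V + star n V] (mod cyc n)"
    and W: "[g * star n g = [:poly g 1:] + W + star n W] (mod cyc n)"
    by blast
  have poly_1_add: "[:poly (f + g) 1:] = [:poly f 1:] + [:poly g 1:]"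
    by simp
  have "(f + g) * star n (f + g) = f * star n f + g * star n g + (f * star n g + star n f * g)"
    by (simp add: star_add algebra_simps)
  also have "[\<dots> = ([:poly f 1:] + V + star n V) + ([:poly g 1:] + W + star n W)
      + (f * star n g + star n f * star n (star n g))] (mod cyc n)" (is "[_ = ?r] (mod _)")
    by (intro cong_add V W cong_refl cong_scalar_left cong_sym[OF star_star] assms)
  also have "?r = [:poly (f + g) 1:] + (V + W + f * star n g) + star n (V + W + f * star n g)"
    unfolding poly_1_add by (simp add: star_add star_mult ac_simps)
  finally show ?case
    by blast
qed (auto intro: exI[of _ 0])

lemma hermitian_one_norm:
  assumes "n > 0" "poly f 1 = 1"
  shows "hermitian_one n (f * star n f)"
  using norm_cong[OF assms(1), of f] assms(2) by (simp add: hermitian_one_def one_pCons)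

text \<open>A power of \<open>x\<close> and its inverse cancel modulo \<open>cyc 4\<close> if the
  exponent is even and add up to \<open>x + x^3\<close> if it is odd. The derivative at 1 counts odd
  exponents modulo 2.\<close>

lemma cong_add_star_pderiv:
  "[W + star 4 W = smult (poly (pderiv W) 1) (xp 1 + xp 3)] (mod cyc 4)"
proof (induction W rule: gf2_poly_induct)
  case (xp k)
  have *: "[xp k + xp (k * 3) = xp i + xp j] (mod cyc 4)"
    if "[k = i] (mod 4)" "[k * 3 = j] (mod 4)" for i j
    using that by (intro cong_add xp_cong)
  define i where "i = k mod 4"
  have i: "k mod 4 = i" "i = 0 \<or> i = 1 \<or> i = 2 \<or> i = 3"
    unfolding i_def by (rule refl, linarith)
  have ki: "[k = i] (mod 4)" "[k * 3 = i * 3 mod 4] (mod 4)"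
    unfolding i_def cong_def by (simp_all add: mod_mult_left_eq)
  have even_iff: "even k \<longleftrightarrow> even i"
    using i(1) dvd_mod_iff[of 2 4 k] by simp
  have k: "of_nat k = (if even i then 0 else 1 :: gf2)"
  proof (cases "even k")
    case True
    then obtain l where "k = 2 * l" ..
    then show ?thesis using True even_iff by simp
  next
    case False
    then obtain l where "k = 2 * l + 1" by (rule oddE)
    then show ?thesis using False even_iff by simp
  qed
  have "[xp k + xp (k * 3) = (if even i then 0 else xp 1 + xp 3)] (mod cyc 4)"
    using *[OF ki] i(2) by (elim disjE) (simp_all add: add.commute[of "xp 3"])
  then show ?case
    by (cases "even i") (simp_all add: star_xp pderiv_monom poly_monom k)
next
  case (add f g)
  have "f + g + star 4 (f + g) = (f + star 4 f) + (g + star 4 g)"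
    by (simp add: star_add)
  also have "[\<dots> = smult (poly (pderiv f) 1) (xp 1 + xp 3) + smult (poly (pderiv g) 1) (xp 1 + xp 3)] (mod cyc 4)"
    (is "[_ = ?r] (mod _)")
    by (intro cong_add add)
  also have "?r = smult (poly (pderiv (f + g)) 1) (xp 1 + xp 3)"
    by (simp add: pderiv_add smult_add_left)
  finally show ?case .
qed simp

text \<open>The exponents 0 and \<open>h\<close> are their own negatives modulo
  \<open>2 * h\<close>; every other \<open>k\<close> is paired with
  \<open>2 * h - k\<close>.\<close>

lemma symmetric_vector_cong:
  assumes "symmetric_vector (2 * h) u" "h > 0"
  shows "[(\<Sum>k<2 * h. monom (u k) k) = [:u 0:] + monom (u h) h
           + (\<Sum>k\<in>{0<..<h}. monom (u k) k) + star (2 * h) (\<Sum>k\<in>{0<..<h}. monom (u k) k)] (mod cyc (2 * h))"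
proof -
  let ?W = "\<Sum>k\<in>{0<..<h}. monom (u k) k"
  have star: "[star (2 * h) (monom c k) = monom c (2 * h - k)] (mod cyc (2 * h))" if "k < h" for c k
  proof -
    have "[k * (2 * h - 1) = 2 * h - k] (mod 2 * h)"
      unfolding cong_iff_lin_nat
    proof (intro exI)
      obtain d where "h = k + Suc d" using \<open>k < h\<close> less_iff_Suc_add by auto
      then show "2 * h - k + k * (2 * h) = k * (2 * h - 1) + 1 * (2 * h)"
        by (simp add: algebra_simps)
    qed
    then have "[xp (k * (2 * h - 1)) = xp (2 * h - k)] (mod cyc (2 * h))"
      by (rule xp_cong)
    then show ?thesis
      using gf2_cases[of c] by (auto simp: star_xp)
  qed
  have starW: "star (2 * h) ?W = (\<Sum>k\<in>{0<..<h}. star (2 * h) (monom (u k) k))"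
    by (simp add: star_def pcompose_sum)
  have set: "{..<2 * h} = {0, h} \<union> {0<..<h} \<union> {h<..<2 * h}"
    using assms(2) by auto
  have "(\<Sum>k<2 * h. monom (u k) k) = [:u 0:] + monom (u h) h + ?W + (\<Sum>k\<in>{h<..<2 * h}. monom (u k) k)"
    unfolding set using assms(2) by (subst sum.union_disjoint, simp, simp, force)+ (simp add: monom_0)
  also have "(\<Sum>k\<in>{h<..<2 * h}. monom (u k) k) = (\<Sum>k\<in>{0<..<h}. monom (u (2 * h - k)) (2 * h - k))"
    by (rule sum.reindex_bij_witness[of _ "\<lambda>k. 2 * h - k" "\<lambda>k. 2 * h - k"]) auto
  also have "\<dots> = (\<Sum>k\<in>{0<..<h}. monom (u k) (2 * h - k))"
  proof (rule sum.cong[OF refl])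
    fix k assume "k \<in> {0<..<h}"
    then have "1 \<le> k \<and> k \<le> 2 * h - 1"
      by auto
    then have "u k = u (2 * h - k)"
      using assms(1) unfolding symmetric_vector_def by blast
    then show "monom (u (2 * h - k)) (2 * h - k) = monom (u k) (2 * h - k)"
      by simp
  qed
  also have "[[:u 0:] + monom (u h) h + ?W + \<dots> = [:u 0:] + monom (u h) h + ?W + star (2 * h) ?W] (mod cyc (2 * h))"
    unfolding starW by (intro cong_add cong_refl cong_sum cong_sym[OF star]) simp
  finally show ?thesis .
qed

text \<open>Coefficients are values of \<open>tau\<close>, which \<open>star\<close> preserves while
  negating the exponent.\<close>

lemma symmetric_vector_coeff_mod:
  assumes "n > 0" "[star n f = f] (mod cyc n)"
  shows "symmetric_vector n (coeff (f mod cyc n))"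
  unfolding symmetric_vector_def
proof (intro allI impI)
  fix i assume i: "1 \<le> i \<and> i \<le> n - 1"
  have "tau n (xp (n - i) * f) = tau n (star n (xp (n - i) * f))"
    by (simp add: tau_star assms)
  also have "\<dots> = tau n (xp i * f)"
  proof (rule tau_cong)
    have "[(n - i) * (n - 1) = i] (mod n)"
      unfolding cong_iff_lin_nat
    proof (intro exI)
      have "i < n" using i assms(1) by linarith
      then obtain d where "n = i + Suc d" using less_iff_Suc_add by auto
      then show "i + (n - i) * n = (n - i) * (n - 1) + 1 * n"
        by (simp add: algebra_simps)
    qed
    then show "[star n (xp (n - i) * f) = xp i * f] (mod cyc n)"
      unfolding star_mult star_xp by (intro cong_mult xp_cong assms(2))
  qed
  finally have "tau n (xp (n - i) * f) = tau n (xp i * f)" .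
  moreover have "n - (n - i) = i" "i < n" "n - i < n"
    using i assms(1) by linarith+
  ultimately show "coeff (f mod cyc n) i = coeff (f mod cyc n) (n - i)"
    by (simp add: coeff_mod_cyc)
qed

lemma star_invariant_cong:
  assumes "h > 0" "[star (2 * h) f = f] (mod cyc (2 * h))"
  obtains c d W where "[f = [:c:] + monom d h + W + star (2 * h) W] (mod cyc (2 * h))"
proof -
  have "symmetric_vector (2 * h) (coeff (f mod cyc (2 * h)))"
    using assms by (intro symmetric_vector_coeff_mod) auto
  from cong_trans[OF cong_sum_coeff_mod symmetric_vector_cong[OF this assms(1)]] assms(1) that
  show thesis by auto
qed

section \<open>Lifting norms along \<open>x^h - 1\<close>, whose square is
  \<open>x^(2h) - 1\<close>\<close>

lemma cyc_double: "cyc (2 * h) = cyc h * cyc h"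
proof -
  have "xp (2 * h) = xp h * xp h"
    by (simp add: mult_monom mult_2)
  then show ?thesis
    by (simp add: cyc_def gf2_poly_diff algebra_simps)
qed

lemma star_cyc_half: "[star (2 * h) (cyc h) = cyc h] (mod cyc (2 * h))"
proof (cases "h = 0")
  case False
  have "[h * (2 * h - 1) = h] (mod 2 * h)"
    unfolding cong_iff_lin_nat
    by (rule exI[of _ "h - 1"], rule exI[of _ 0]) (use False in \<open>cases h, simp_all add: algebra_simps\<close>)
  then have "[xp (h * (2 * h - 1)) + 1 = xp h + 1] (mod cyc (2 * h))"
    by (intro cong_add xp_cong) simp_all
  moreover have h1: "cyc h = xp h + 1"
    by (simp add: cyc_def gf2_poly_diff)
  have "star (2 * h) (cyc h) = xp (h * (2 * h - 1)) + 1"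
    unfolding h1 star_add star_xp star_1 ..
  ultimately show ?thesis
    using h1 by metis
qed (simp add: cyc_def)

text \<open>Since \<open>cyc h\<close> squares to zero modulo \<open>cyc (2 * h)\<close>,
  multiplying units congruent to 1 modulo \<open>cyc h\<close> amounts to adding the
  cofactors.\<close>

lemma one_plus_cyc_half_mult:
  "[(1 + cyc h * V) * (1 + cyc h * W) = 1 + cyc h * (V + W)] (mod cyc (2 * h))"
proof -
  have "(1 + cyc h * V) * (1 + cyc h * W) - (1 + cyc h * (V + W)) = cyc (2 * h) * (V * W)"
    unfolding cyc_double by (simp add: algebra_simps)
  then show ?thesis
    by (simp add: cong_iff_dvd_diff)
qed

lemma one_plus_cyc_half_norm:
  "[(1 + cyc h * V) * star (2 * h) (1 + cyc h * V) = 1 + cyc h * (V + star (2 * h) V)] (mod cyc (2 * h))"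
proof -
  have "[(1 + cyc h * V) * star (2 * h) (1 + cyc h * V)
       = (1 + cyc h * V) * (1 + cyc h * star (2 * h) V)] (mod cyc (2 * h))"
    unfolding star_add star_mult by (intro cong_scalar_left cong_add cong_scalar_right star_cyc_half) simp
  with one_plus_cyc_half_mult show ?thesis
    using cong_trans by blast
qed

text \<open>The monomial \<open>xp (2 * r)\<close> is symmetric modulo \<open>cyc (4 * r)\<close>
  but not of the form \<open>V + star V\<close>, so norms of elements
  \<open>1 + cyc (4 * r) * V\<close> miss it. This trinomial supplies it, together with a harmless
  term of that form.\<close>

lemma trinomial_norm:
  assumes "r > 0"
  shows "[(1 + xp r + xp (3 * r)) * star (8 * r) (1 + xp r + xp (3 * r))
     = 1 + cyc (4 * r) * (xp r + star (8 * r) (xp r) + xp (2 * r))] (mod cyc (8 * r))"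
proof -
  have s1: "[star (8 * r) (xp r) = xp (7 * r)] (mod cyc (8 * r))"
    unfolding star_xp
  proof (intro xp_cong, unfold cong_iff_lin_nat, intro exI)
    show "7 * r + r * (8 * r) = r * (8 * r - 1) + 1 * (8 * r)"
      using assms by (cases r) (simp_all add: algebra_simps)
  qed
  have s3: "[star (8 * r) (xp (3 * r)) = xp (5 * r)] (mod cyc (8 * r))"
    unfolding star_xp
  proof (intro xp_cong, unfold cong_iff_lin_nat, intro exI)
    show "5 * r + (3 * r) * (8 * r) = 3 * r * (8 * r - 1) + 1 * (8 * r)"
      using assms by (cases r) (simp_all add: algebra_simps)
  qed
  have "[(1 + xp r + xp (3 * r)) * star (8 * r) (1 + xp r + xp (3 * r))
     = (1 + xp r + xp (3 * r)) * (1 + xp (7 * r) + xp (5 * r))] (mod cyc (8 * r))"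
    unfolding star_add by (intro cong_scalar_left cong_add s1 s3) simp
  also have "[(1 + xp r + xp (3 * r)) * (1 + xp (7 * r) + xp (5 * r))
     = 1 + cyc (4 * r) * (xp r + xp (7 * r) + xp (2 * r))] (mod cyc (8 * r))"
  proof -
    define z where "z = xp r"
    have z: "xp (k * r) = z ^ k" for k
      by (simp add: z_def xp_power mult.commute)
    have "(1 + z + z ^ 3) * (1 + z ^ 7 + z ^ 5) - (1 + (z ^ 4 - 1) * (z + z ^ 7 + z ^ 2)) =
      (z ^ 8 - 1) * (z ^ 3 + z ^ 2)"
      by (simp add: gf2_poly_diff algebra_simps power2_eq_square flip: power_Suc power_add)
    then show ?thesis
      by (simp add: cong_iff_dvd_diff cyc_def z flip: z_def)
  qed
  also have "[1 + cyc (4 * r) * (xp r + xp (7 * r) + xp (2 * r)) =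
      1 + cyc (4 * r) * (xp r + star (8 * r) (xp r) + xp (2 * r))] (mod cyc (8 * r))"
    by (intro cong_add cong_scalar_left cong_sym[OF s1]) simp_all
  finally show ?thesis .
qed

text \<open>Write \<open>U = 1 + cyc h * Q\<close> with \<open>h = 4 * r\<close>. Symmetry makes
  \<open>Q\<close> equal to \<open>V + star V\<close> up to a constant and a middle term; the
  constant vanishes and the trinomial accounts for the middle term.\<close>

lemma norm_surj_aux:
  assumes "r > 0" "[U = 1] (mod cyc (4 * r))" "hermitian_one (8 * r) U"
  obtains g where "[g * star (8 * r) g = U] (mod cyc (8 * r))"
proof -
  let ?n = "8 * r" and ?h = "4 * r"
  have cyc_n: "cyc ?n = cyc ?h * cyc ?h"
    using cyc_double[of ?h] by simp
  have n0: "?n > 0" using assms(1) by simp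
  obtain W where W: "[U = 1 + W + star ?n W] (mod cyc ?n)"
    using assms(3) by (auto simp: hermitian_one_def)
  define X where "X = W + star ?n W"
  have UX: "[U = 1 + X] (mod cyc ?n)"
    using W by (simp add: X_def add.assoc)
  have "[1 + X = 1 + 0] (mod cyc ?h)"
    using cong_trans[OF cong_sym[OF cong_dvd_modulus[OF UX cyc_dvd]] assms(2)] by simp
  then have "cyc ?h dvd X"
    by (simp only: cong_add_lcancel cong_0_iff)
  then obtain Q where Q: "X = cyc ?h * Q" ..
  have star_h: "[star ?n (cyc ?h) = cyc ?h] (mod cyc ?n)"
    using star_cyc_half[of ?h] by simp
  have X_star: "[star ?n X = X] (mod cyc ?n)"
  proof -
    have "[star ?n W + star ?n (star ?n W) = star ?n W + W] (mod cyc ?n)"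
      by (intro cong_add star_star n0 cong_refl)
    then show ?thesis
      by (simp add: X_def star_add add.commute)
  qed
  have "[star ?n X = cyc ?h * star ?n Q] (mod cyc ?n)"
    unfolding Q star_mult by (intro cong_scalar_right star_h)
  from cong_trans[OF cong_sym[OF this] X_star]
  have "[cyc ?h * star ?n Q = cyc ?h * Q] (mod cyc ?h * cyc ?h)"
    by (simp only: Q flip: cyc_n)
  \<comment> \<open>One factor \<open>cyc h\<close> is cancelled, so the modulus drops from its
    square to \<open>cyc h\<close>.\<close>
  then have Q1: "[star ?n Q = Q] (mod cyc ?h)"
    using cyc_nonzero[of ?h] assms(1)
    by (simp add: cong_iff_dvd_diff flip: right_diff_distrib)
  have star_nh: "[star ?n f = star ?h f] (mod cyc ?h)" for f
    by (intro star_cong_dvd n0) simp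
  have h2: "2 * (2 * r) = ?h"
    by simp
  have "[star ?h Q = Q] (mod cyc ?h)"
    by (rule cong_trans[OF cong_sym[OF star_nh] Q1])
  then obtain c d V where V: "[Q = [:c:] + monom d (2 * r) + V + star ?h V] (mod cyc ?h)"
    using star_invariant_cong[of "2 * r" Q] assms(1) unfolding h2 by auto
  note V
  also have "[[:c:] + monom d (2 * r) + V + star ?h V = [:c:] + monom d (2 * r) + V + star ?n V] (mod cyc ?h)"
    by (intro cong_add cong_refl cong_sym[OF star_nh])
  also have "[:c:] + monom d (2 * r) + V + star ?n V = [:c:] + monom d (2 * r) + (V + star ?n V)"
    by (simp only: add.assoc)
  finally have "[X = cyc ?h * ([:c:] + monom d (2 * r) + (V + star ?n V))] (mod cyc ?h * cyc ?h)"
    unfolding Q by (rule cong_cmult_leftI)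
  then have X: "[X = cyc ?h * ([:c:] + monom d (2 * r) + (V + star ?n V))] (mod cyc ?n)"
    by (simp only: cyc_n)
  \<comment> \<open>The constant coefficient of \<^term>\<open>W + star n W\<close> vanishes, hence so does \<^term>\<open>c\<close>.\<close>
  have "c = 0"
  proof -
    have "0 = tau ?n X"
      unfolding X_def tau_add tau_star[OF n0] by (simp flip: mult_2)
    also have "\<dots> = tau ?n (cyc ?h * [:c:]) + tau ?n (cyc ?h * monom d (2 * r))
        + (tau ?n (cyc ?h * V) + tau ?n (cyc ?h * star ?n V))"
      unfolding tau_cong[OF X] by (simp add: distrib_left tau_add)
    also have "tau ?n (cyc ?h * star ?n V) = tau ?n (star ?n (cyc ?h * V))"
      unfolding star_mult by (intro tau_cong cong_scalar_right cong_sym[OF star_h])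
    also have "\<dots> = tau ?n (cyc ?h * V)"
      by (rule tau_star[OF n0])
    also have "cyc ?h * [:c:] = smult c (xp ?h + xp 0)"
      by (simp add: cyc_def gf2_poly_diff smult_add_right)
    also have "cyc ?h * monom d (2 * r) = smult d (xp (6 * r) + xp (2 * r))"
      by (simp add: cyc_def gf2_poly_diff distrib_right mult_monom smult_add_right smult_monom)
    also have "tau ?n (smult c (xp ?h + xp 0)) = c"
      unfolding tau_smult tau_add tau_xp[OF n0] using assms(1) by simp
    also have "tau ?n (smult d (xp (6 * r) + xp (2 * r))) = 0"
      unfolding tau_smult tau_add tau_xp[OF n0] using assms(1) by simp
    finally show ?thesis
      by simp
  qed
  show thesis
  proof (cases "d = 0")
    case True
    have "[(1 + cyc ?h * V) * star ?n (1 + cyc ?h * V) = 1 + cyc ?h * (V + star ?n V)] (mod cyc ?n)"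
      using one_plus_cyc_half_norm[of ?h V] by simp
    also have "[1 + cyc ?h * (V + star ?n V) = 1 + X] (mod cyc ?n)"
      using X True \<open>c = 0\<close> by (intro cong_add cong_refl) (simp add: cong_sym)
    finally show ?thesis
      by (rule that[OF cong_trans[OF _ cong_sym[OF UX]]])
  next
    case False
    then have [simp]: "d = 1"
      using gf2_cases by blast
    \<comment> \<open>The norm of \<open>t\<close> brings in the middle term along with
      \<open>Z + star Z\<close>; using \<open>V + Z\<close> instead of \<open>V\<close> in
      \<open>g\<close> cancels the latter.\<close>
    define Z where "Z = xp r"
    define t where "t = 1 + Z + xp (3 * r)"
    define g where "g = 1 + cyc ?h * (V + Z)"
    have near_one: "[(1 + cyc ?h * V) * (1 + cyc ?h * W) = 1 + cyc ?h * (V + W)] (mod cyc ?n)" for V W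
      using one_plus_cyc_half_mult[of ?h V W] by simp
    have "(t * g) * star ?n (t * g) = (t * star ?n t) * (g * star ?n g)"
      by (simp add: star_mult algebra_simps)
    also have "[\<dots> = (1 + cyc ?h * (Z + star ?n Z + xp (2 * r)))
        * (1 + cyc ?h * ((V + Z) + star ?n (V + Z)))] (mod cyc ?n)"
      unfolding t_def g_def Z_def
      using trinomial_norm[OF assms(1)] one_plus_cyc_half_norm[of ?h "V + xp r"]
      by (intro cong_mult) simp_all
    also have "[(1 + cyc ?h * (Z + star ?n Z + xp (2 * r)))
        * (1 + cyc ?h * ((V + Z) + star ?n (V + Z)))
        = 1 + cyc ?h * ((Z + star ?n Z + xp (2 * r)) + ((V + Z) + star ?n (V + Z)))] (mod cyc ?n)"
      by (rule near_one)
    also have "(Z + star ?n Z + xp (2 * r)) + ((V + Z) + star ?n (V + Z))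
        = [:c:] + monom d (2 * r) + (V + star ?n V)"
      by (simp add: \<open>c = 0\<close> star_add algebra_simps)
    also have "[1 + cyc ?h * ([:c:] + monom d (2 * r) + (V + star ?n V)) = 1 + X] (mod cyc ?n)"
      using X by (intro cong_add cong_refl) (simp add: cong_sym)
    finally show ?thesis
      by (rule that[OF cong_trans[OF _ cong_sym[OF UX]]])
  qed
qed

text \<open>Induction on the order. A solution \<open>f\<close> for half the order has the right
  norm modulo \<open>cyc h\<close>; dividing \<open>U\<close> by that norm leaves an element
  congruent to 1 there, to which the lifting step applies.\<close>

lemma norm_surj:
  assumes "hermitian_one (2 ^ (s + 2)) U" "[U = 1] (mod cyc 4)"
  shows "\<exists>f. [f * star (2 ^ (s + 2)) f = U] (mod cyc (2 ^ (s + 2)))"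
  using assms
proof (induction s arbitrary: U)
  case 0
  then show ?case
    by (intro exI[of _ 1]) (simp add: cong_sym)
next
  case (Suc s)
  define h where "h = (2::nat) ^ (s + 2)"
  define n where "n = (2::nat) ^ (Suc s + 2)"
  have hn: "h dvd n" and n0: "n > 0"
    by (simp_all add: h_def n_def)
  have herm: "hermitian_one n U"
    using Suc.prems by (simp add: n_def)
  obtain f where f: "[f * star h f = U] (mod cyc h)"
    using Suc.IH[of U] hermitian_one_dvd[OF hn n0 herm] Suc.prems(2) unfolding h_def by blast
  have fn: "[f * star n f = U] (mod cyc h)"
    using cong_scalar_left[OF star_cong_dvd[OF hn n0], of f f] f cong_trans by blast
  have f1: "poly f 1 = 1"
    using poly_1_cong[OF f] hermitian_one_poly_1[OF herm] gf2_cases[of "poly f 1"] by auto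
  \<comment> \<open>The inverse of \<open>f\<close> modulo \<open>cyc n\<close>, available because
    \<open>poly f 1 = 1\<close>.\<close>
  define k where "k = f ^ (n - 1)"
  have "k * f = f ^ n"
    using n0 by (simp add: k_def flip: power_Suc2)
  then have kf: "[k * f = 1] (mod cyc n)"
    using power_cong_poly_1[of f "Suc s + 2"] by (simp add: n_def f1 one_pCons)
  have kf2: "[(k * f) * star n (k * f) = 1] (mod cyc n)"
    using cong_mult[OF kf star_cong[OF kf]] by simp
  define V where "V = U * (k * star n k)"
  have "hermitian_one n V"
    unfolding V_def by (intro hermitian_one_mult hermitian_one_norm n0 herm) (simp add: k_def f1)
  moreover have "[V = 1] (mod cyc h)"
  proof -
    have "[V = f * star n f * (k * star n k)] (mod cyc h)"
      unfolding V_def by (intro cong_scalar_right cong_sym[OF fn])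
    also have "f * star n f * (k * star n k) = (k * f) * star n (k * f)"
      by (simp add: star_mult algebra_simps)
    also have "[(k * f) * star n (k * f) = 1] (mod cyc h)"
      using cong_dvd_modulus[OF kf2 cyc_dvd[OF hn]] .
    finally show ?thesis .
  qed
  moreover have "n = 8 * 2 ^ s" "h = 4 * 2 ^ s"
    by (simp_all add: n_def h_def)
  ultimately obtain g where g: "[g * star n g = V] (mod cyc n)"
    using norm_surj_aux[of "2 ^ s" V] by auto
  have "(g * f) * star n (g * f) = (g * star n g) * (f * star n f)"
    by (simp add: star_mult algebra_simps)
  also have "[\<dots> = V * (f * star n f)] (mod cyc n)"
    by (intro cong_scalar_right g)
  also have "V * (f * star n f) = U * ((k * f) * star n (k * f))"
    by (simp add: V_def star_mult algebra_simps)
  also have "[\<dots> = U * 1] (mod cyc n)"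
    by (intro cong_scalar_left kf2)
  finally show ?case
    unfolding n_def by auto
qed

subsection \<open>The action of polynomials on the field\<close>

text \<open>The linearized polynomial attached to \<open>f\<close>. In characteristic 2 it makes the
  field a module over \<open>GF(2)[x]\<close>, with \<open>x\<close> acting as squaring.\<close>

definition act :: "gf2 poly \<Rightarrow> 'a::field \<Rightarrow> 'a" where
  "act f x = (\<Sum>i\<le>degree f. gf2_embed (coeff f i) * x ^ (2 ^ i))"

text \<open>For a positive divisor \<open>n\<close> of the degree of the field this is the subfield
  with \<open>2 ^ n\<close> elements, given as a set so that all subfields live in one type.\<close>

definition fixed :: "nat \<Rightarrow> 'a::field set" where
  "fixed n = {x. x ^ (2 ^ n) = x}"

text \<open>\<open>G\<close> encodes the corresponding vector: taking \<open>f = xp k\<close> shows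
  that entry \<open>k\<close> is the coefficient of \<open>G\<close> at \<open>-k\<close> modulo
  \<open>n\<close>.\<close>

definition has_form :: "nat \<Rightarrow> 'a::field \<Rightarrow> gf2 poly \<Rightarrow> bool" where
  "has_form n x G \<longleftrightarrow> x \<in> fixed n \<and> (\<forall>f. field_trace n (x * act f x) = gf2_embed (tau n (f * G)))"

text \<open>The module generated by \<open>x\<close> is free of rank one over the group algebra,
  which is normality in terms of annihilators.\<close>

definition generator :: "nat \<Rightarrow> 'a::field \<Rightarrow> bool" where
  "generator n x \<longleftrightarrow> x \<in> fixed n \<and> (\<forall>f. act f x = 0 \<longrightarrow> cyc n dvd f)"

text \<open>The quotient of \<open>cyc n\<close> by \<open>cyc 1\<close>; it acts as the
  trace.\<close>

definition allones :: "nat \<Rightarrow> gf2 poly" where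
  "allones n = (\<Sum>i<n. xp i)"

lemma cyc_eq_allones: "cyc n = cyc 1 * allones n"
  using cyc_mult[of 1 n] by (simp add: allones_def)

lemma allones_nonzero: "n > 0 \<Longrightarrow> allones n \<noteq> 0"
  using cyc_eq_allones[of n] cyc_nonzero[of n] by auto

lemma degree_allones_less:
  assumes "n > 0"
  shows "degree (allones n) < n"
proof -
  have "degree (cyc n) = degree (cyc 1) + degree (allones n)"
    unfolding cyc_eq_allones[of n] by (intro degree_mult_eq cyc_nonzero allones_nonzero assms) simp
  then show ?thesis
    using assms degree_cyc[of n] degree_cyc[of 1] by simp
qed

lemma allones_mult: "allones (n * k) = allones n * (\<Sum>j<k. xp (n * j))"
proof -
  have "cyc 1 * allones (n * k) = cyc 1 * (allones n * (\<Sum>j<k. xp (n * j)))"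
    unfolding mult.assoc[symmetric] cyc_eq_allones[symmetric] by (rule cyc_mult)
  then show ?thesis
    using cyc_nonzero[of 1] by simp
qed

lemma allones_mult_xp: "[allones n * xp k = allones n] (mod cyc n)"
proof -
  have "allones n * xp k - allones n = allones n * cyc k"
    by (simp add: cyc_def algebra_simps)
  also have "\<dots> = cyc n * allones k"
    by (subst (2) cyc_eq_allones, subst cyc_eq_allones) (simp add: algebra_simps)
  finally show ?thesis
    by (simp add: cong_iff_dvd_diff)
qed

lemma gf2_embed_eq_0_iff: "gf2_embed c = (0::'a::field) \<longleftrightarrow> c = 0"
  using gf2_cases[of c] by auto

lemma act_eq:
  assumes "degree f \<le> d"
  shows "act f x = (\<Sum>i\<le>d. gf2_embed (coeff f i) * x ^ (2 ^ i))"
  unfolding act_def using assms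
  by (intro sum.mono_neutral_left) (auto simp: coeff_eq_0)

lemma act_0 [simp]: "act 0 x = 0"
  by (simp add: act_def)

lemma act_xp: "act (xp k) x = x ^ (2 ^ k)"
proof -
  have "act (xp k) x = (\<Sum>i\<le>k. if i = k then x ^ (2 ^ k) else 0)"
    unfolding act_def by (intro sum.cong) (auto simp: degree_monom_eq)
  then show ?thesis
    by simp
qed

lemma act_1 [simp]: "act 1 x = x"
  using act_xp[of 0 x] by simp

section \<open>The field as a module over \<open>GF(2)[x]\<close>\<close>

locale gf2_extension =
  fixes N :: nat and F :: "'a::{field,finite} itself"
  assumes card_field: "CARD('a) = 2 ^ N" and N_pos: "N > 0"
begin

lemma CHAR_2: "CHAR('a) = 2"
proof -
  have "CHAR('a) dvd 2 ^ N"
    using CHAR_dvd_CARD[where 'a = 'a] card_field by simp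
  moreover have "prime CHAR('a)"
    by (rule prime_CHAR_semidom) (use finite_imp_CHAR_pos[where 'a = 'a] in simp)
  ultimately show ?thesis
    by (metis primes_dvd_imp_eq prime_dvd_power two_is_prime_nat)
qed

lemma two_eq_0: "(2::'a) = 0"
  using of_nat_CHAR[where 'a = 'a] by (simp add: CHAR_2)

lemma double: "x + x = (0::'a)"
  by (simp add: two_eq_0 flip: mult_2)

lemma gf2_embed_add: "gf2_embed (c + d) = gf2_embed c + (gf2_embed d :: 'a)"
  using gf2_cases[of c] gf2_cases[of d] two_eq_0 by (elim disjE) simp_all

lemma gf2_embed_mult: "gf2_embed (c * d) = gf2_embed c * (gf2_embed d :: 'a)"
  using gf2_cases[of c] gf2_cases[of d] by (elim disjE) simp_all

lemma frobenius_add: "(x + y) ^ (2 ^ k) = x ^ (2 ^ k) + (y::'a) ^ (2 ^ k)"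
  by (rule freshmans_dream') (simp_all add: CHAR_2)

lemma fixed_N: "x \<in> (fixed N :: 'a set)"
proof (cases "x = 0")
  case False
  \<comment> \<open>Multiplication by a nonzero \<open>x\<close> permutes the nonzero elements, so
    their product can be cancelled.\<close>
  have "(\<Prod>y\<in>UNIV - {0}. y) = (\<Prod>y\<in>UNIV - {0::'a}. x * y)"
    by (rule prod.reindex_bij_witness[of _ "\<lambda>y. x * y" "\<lambda>y. y / x"]) (use False in auto)
  also have "\<dots> = x ^ (2 ^ N - 1) * (\<Prod>y\<in>UNIV - {0}. y)"
    by (simp add: prod.distrib card_Diff_singleton card_field)
  finally have "x ^ (2 ^ N - 1) = 1"
    by simp
  then have "x ^ Suc (2 ^ N - 1) = x"
    by (simp only: power_Suc mult_1_right)
  moreover have "Suc (2 ^ N - 1) = 2 ^ N"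
    by simp
  ultimately show ?thesis
    unfolding fixed_def by simp
qed (simp add: fixed_def)

lemma act_add: "act (f + g) x = act f x + act g (x::'a)"
proof -
  define d where "d = max (degree f) (degree g)"
  have "degree (f + g) \<le> d" "degree f \<le> d" "degree g \<le> d"
    by (simp_all add: d_def degree_add_le_max)
  then show ?thesis
    by (simp add: act_eq gf2_embed_add sum.distrib distrib_right)
qed

lemma act_sum: "act (\<Sum>i\<in>A. f i) x = (\<Sum>i\<in>A. act (f i) (x::'a))"
  by (induction A rule: infinite_finite_induct) (simp_all add: act_add)

lemma act_add_right: "act f (x + y) = act f x + act f (y::'a)"
  by (simp add: act_def frobenius_add sum.distrib distrib_left)

lemma act_0_right [simp]: "act f (0::'a) = 0"
  by (simp add: act_def power_0_left)

lemma act_xp_mult: "act (xp k * g) x = act g (x::'a) ^ (2 ^ k)"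
proof (induction g rule: gf2_poly_induct)
  case (xp j)
  then show ?case
    by (simp add: mult_monom act_xp power_add mult.commute flip: power_mult)
qed (simp_all add: distrib_left act_add frobenius_add power_0_left)

lemma act_mult: "act (f * g) x = act f (act g (x::'a))"
  by (induction f rule: gf2_poly_induct)
    (simp_all add: act_xp_mult act_xp act_add distrib_right)

lemma fixed_iff_act: "x \<in> (fixed n :: 'a set) \<longleftrightarrow> act (cyc n) x = 0"
proof -
  have "act (cyc n) x = x ^ (2 ^ n) + x"
    by (simp add: cyc_def gf2_poly_diff act_add act_xp)
  then show ?thesis
    unfolding fixed_def mem_Collect_eq by (metis add_right_cancel double)
qed

lemma act_in_fixed: "x \<in> fixed n \<Longrightarrow> act f x \<in> (fixed n :: 'a set)"
  unfolding fixed_iff_act by (metis act_mult act_0_right mult.commute)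

lemma frobenius_in_fixed: "x \<in> fixed n \<Longrightarrow> x ^ (2 ^ k) \<in> (fixed n :: 'a set)"
  using act_in_fixed[of x n "xp k"] by (simp add: act_xp)

lemma add_in_fixed: "x \<in> fixed n \<Longrightarrow> y \<in> fixed n \<Longrightarrow> x + y \<in> (fixed n :: 'a set)"
  by (simp add: fixed_def frobenius_add)

lemma mult_in_fixed: "x \<in> fixed n \<Longrightarrow> y \<in> fixed n \<Longrightarrow> x * y \<in> (fixed n :: 'a set)"
  by (simp add: fixed_def power_mult_distrib)

lemma act_cong:
  assumes "x \<in> fixed n" "[f = g] (mod cyc n)"
  shows "act f x = act g (x::'a)"
proof -
  have "cyc n dvd f - g"
    using assms(2) by (simp add: cong_iff_dvd_diff)
  then obtain h where "f - g = cyc n * h" ..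
  then have "f = g + h * cyc n"
    by (simp add: algebra_simps)
  then show ?thesis
    using assms(1) by (simp add: act_add act_mult fixed_iff_act)
qed

lemma frobenius_cong:
  assumes "x \<in> fixed n" "[i = j] (mod n)"
  shows "x ^ (2 ^ i) = (x::'a) ^ (2 ^ j)"
  using act_cong[OF assms(1) xp_cong[OF assms(2)]] by (simp add: act_xp)

section \<open>The trace and existence of elements with nonzero image\<close>

lemma trace_eq_act: "field_trace n x = act (allones n) (x::'a)"
  by (simp add: field_trace_def allones_def act_sum act_xp)

lemma trace_0 [simp]: "field_trace n (0::'a) = 0"
  by (simp add: trace_eq_act)

lemma trace_add: "field_trace n (x + y) = field_trace n x + field_trace n (y::'a)"
  by (simp add: trace_eq_act act_add_right)

lemma trace_frobenius:
  assumes "x \<in> fixed n"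
  shows "field_trace n (x ^ (2 ^ k)) = field_trace n (x::'a)"
  using act_cong[OF assms allones_mult_xp[of n k]]
  by (simp add: trace_eq_act act_mult act_xp)

lemma trace_in_gf2:
  assumes "x \<in> (fixed n :: 'a set)"
  shows "\<exists>c. gf2_embed c = field_trace n x"
proof -
  have "field_trace n x ^ 2 = act (xp 1 * allones n) x"
    by (simp add: act_xp_mult trace_eq_act del: One_nat_def)
  also have "\<dots> = act (allones n * xp 1) x"
    by (simp only: mult.commute)
  also have "\<dots> = field_trace n x"
    unfolding trace_eq_act using allones_mult_xp assms by (intro act_cong)
  finally have "field_trace n x * (field_trace n x - 1) = 0"
    by (simp add: algebra_simps power2_eq_square)
  then have "field_trace n x = 0 \<or> field_trace n x = 1"
    by simp
  then show ?thesis
    by (metis gf2_embed_0 gf2_embed_1)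
qed

text \<open>The trace is invariant under Frobenius powers, so a power of \<open>x\<close> acting on
  one factor can be moved to the other as its inverse.\<close>

lemma trace_adjoint:
  assumes "x \<in> fixed n" "y \<in> fixed n" "n > 0"
  shows "field_trace n (act f x * y) = field_trace n (x * act (star n f) (y::'a))"
proof (induction f rule: gf2_poly_induct)
  case (xp k)
  have "y ^ (2 ^ (k * (n - 1) + k)) = y ^ (2 ^ 0)"
  proof (rule frobenius_cong[OF assms(2)])
    have "k * (n - 1) + k = n * k"
      using assms(3) by (cases n) simp_all
    then show "[k * (n - 1) + k = 0] (mod n)"
      by (simp add: cong_def)
  qed
  then have "(x * y ^ (2 ^ (k * (n - 1)))) ^ (2 ^ k) = x ^ (2 ^ k) * y"
    by (simp add: power_mult_distrib power_add flip: power_mult)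
  moreover have "x * y ^ (2 ^ (k * (n - 1))) \<in> fixed n"
    by (intro mult_in_fixed frobenius_in_fixed assms)
  ultimately show ?case
    using trace_frobenius[of "x * y ^ (2 ^ (k * (n - 1)))" n k] by (simp add: act_xp star_xp)
qed (simp_all add: act_add star_add trace_add distrib_left distrib_right)

text \<open>The linearized polynomial is nonzero of degree below the size of the field, hence has
  too few roots to vanish everywhere.\<close>

lemma act_nonvanishing:
  assumes "f \<noteq> 0" "degree f < N"
  obtains x :: 'a where "act f x \<noteq> 0"
proof -
  define P :: "'a poly" where "P = (\<Sum>i\<le>degree f. monom (gf2_embed (coeff f i)) (2 ^ i))"
  have poly: "poly P x = act f x" for x
    by (simp add: P_def poly_sum poly_monom act_def)
  have "coeff P (2 ^ degree f) = (\<Sum>i\<le>degree f. if i = degree f then gf2_embed (lead_coeff f) else 0)"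
    by (auto simp: P_def coeff_sum intro!: sum.cong)
  also have "\<dots> = gf2_embed (lead_coeff f)"
    by simp
  finally have "P \<noteq> 0"
    using assms(1) by (auto simp: gf2_embed_eq_0_iff)
  have "degree P \<le> 2 ^ degree f"
    unfolding P_def
  proof (intro degree_sum_le)
    fix i assume "i \<in> {..degree f}"
    then have "(2::nat) ^ i \<le> 2 ^ degree f"
      by (intro power_increasing) auto
    then show "degree (monom (gf2_embed (coeff f i) :: 'a) (2 ^ i)) \<le> 2 ^ degree f"
      using degree_monom_le le_trans by blast
  qed simp
  also have "(2::nat) ^ degree f < CARD('a)"
    unfolding card_field using assms(2) by simp
  finally have "card {x. poly P x = 0} < CARD('a)"
    using card_poly_roots_bound[OF \<open>P \<noteq> 0\<close>] by simp
  then have "{x. poly P x = 0} \<noteq> UNIV"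
    by auto
  then show ?thesis
    using that poly by auto
qed

lemma card_fixed_le:
  assumes "n > 0"
  shows "card (fixed n :: 'a set) \<le> 2 ^ n"
proof -
  define P :: "'a poly" where "P = monom 1 (2 ^ n) - monom 1 1"
  have "(1::nat) < 2 ^ n"
    by (rule one_less_power) (use assms in simp_all)
  then have "coeff P (2 ^ n) = 1" "degree P \<le> 2 ^ n"
    by (auto simp: P_def degree_monom_eq intro!: degree_diff_le)
  moreover have "fixed n = {x. poly P x = 0}"
    by (auto simp: fixed_def P_def poly_monom)
  ultimately show ?thesis
    using card_poly_roots_bound[of P] by fastforce
qed

text \<open>With \<open>cyc N = cyc n * Q\<close>, every \<open>act Q z\<close> lies in
  \<open>fixed n\<close>, and \<open>q * Q\<close> still has degree below \<open>N\<close>, so it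
  does not annihilate all \<open>z\<close>.\<close>

lemma lift_fixed:
  assumes "N = n * k" "n > 0" "q \<noteq> 0" "degree q < n"
  obtains x where "x \<in> (fixed n :: 'a set)" "act q x \<noteq> 0"
proof -
  define Q where "Q = (\<Sum>j<k. xp (n * j))"
  have Q: "cyc N = cyc n * Q"
    unfolding assms(1) Q_def by (rule cyc_mult)
  then have "Q \<noteq> 0" "cyc n \<noteq> 0"
    using cyc_nonzero[OF N_pos] by auto
  then have "N = n + degree Q"
    using Q assms(2) N_pos by (metis degree_cyc degree_mult_eq)
  then have "degree (q * Q) < N" "q * Q \<noteq> 0"
    using assms(3,4) \<open>Q \<noteq> 0\<close> by (simp_all add: degree_mult_eq)
  then obtain z :: 'a where "act (q * Q) z \<noteq> 0"
    using act_nonvanishing by blast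
  moreover have "act Q z \<in> fixed n"
    using fixed_N[of z] by (simp add: fixed_iff_act Q act_mult)
  ultimately show ?thesis
    using that by (simp add: act_mult)
qed

lemma trace_one:
  assumes "N = n * k" "n > 0"
  obtains x where "x \<in> (fixed n :: 'a set)" "field_trace n x = 1"
proof -
  obtain x :: 'a where x: "x \<in> fixed n" "act (allones n) x \<noteq> 0"
    using lift_fixed[OF assms allones_nonzero degree_allones_less] assms(2) by blast
  moreover obtain c where "gf2_embed c = field_trace n x"
    using trace_in_gf2[OF x(1)] by blast
  ultimately show ?thesis
    using that gf2_cases[of c] by (auto simp: trace_eq_act)
qed

lemma trace_act_fixed:
  assumes "x \<in> (fixed n :: 'a set)"
  shows "\<exists>t. \<forall>k. gf2_embed (t k) = field_trace n (x * x ^ (2 ^ k))"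
  using trace_in_gf2[OF mult_in_fixed[OF assms frobenius_in_fixed[OF assms]]] by metis

section \<open>Trace forms as elements of the group algebra\<close>

lemma has_formI:
  assumes "x \<in> (fixed n :: 'a set)"
    and "\<And>k. field_trace n (x * x ^ (2 ^ k)) = gf2_embed (tau n (xp k * G))"
  shows "has_form n x G"
  unfolding has_form_def
proof (intro conjI allI assms(1))
  fix f show "field_trace n (x * act f x) = gf2_embed (tau n (f * G))"
    by (induction f rule: gf2_poly_induct)
      (simp_all add: act_xp assms act_add distrib_left distrib_right trace_add tau_add gf2_embed_add)
qed

lemma form_exists:
  assumes x: "x \<in> (fixed n :: 'a set)" and n: "n > 0"
  obtains G where "has_form n x G"
proof -
  obtain t where t: "gf2_embed (t k) = field_trace n (x * x ^ (2 ^ k))" for k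
    using trace_act_fixed[OF x] by blast
  \<comment> \<open>The exponents \<open>k * (n - 1)\<close> represent \<open>-k\<close>, so that
    \<open>tau n (xp j * G)\<close> selects the entry at \<open>j mod n\<close>.\<close>
  define G where "G = (\<Sum>k<n. smult (t k) (xp (k * (n - 1))))"
  have "has_form n x G"
  proof (rule has_formI[OF x])
    fix j
    have dvd_iff: "n dvd j + k * (n - 1) \<longleftrightarrow> k = j mod n" if "k < n" for k
    proof -
      have "n dvd j + k * (n - 1) \<longleftrightarrow> [j + k * (n - 1) + k = 0 + k] (mod n)"
        unfolding cong_add_rcancel_nat cong_0_iff ..
      also have "j + k * (n - 1) + k = j + k * n"
        using n by (cases n) simp_all
      also have "[j + k * n = 0 + k] (mod n) \<longleftrightarrow> k = j mod n"
        using that by (auto simp: cong_def)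
      finally show ?thesis .
    qed
    have "tau n (xp j * G) = (\<Sum>k<n. t k * tau n (xp (j + k * (n - 1))))"
      by (simp add: G_def sum_distrib_left tau_sum tau_smult mult_monom)
    also have "\<dots> = (\<Sum>k<n. if k = j mod n then t (j mod n) else 0)"
      by (intro sum.cong refl) (simp add: tau_xp n dvd_iff del: One_nat_def)
    also have "\<dots> = t (j mod n)"
      using n by simp
    finally have "gf2_embed (tau n (xp j * G)) = field_trace n (x * x ^ (2 ^ (j mod n)))"
      by (simp add: t)
    also have "x ^ (2 ^ (j mod n)) = x ^ (2 ^ j)"
      using x by (rule frobenius_cong) (simp add: cong_def)
    finally show "field_trace n (x * x ^ (2 ^ j)) = gf2_embed (tau n (xp j * G))" ..
  qed
  then show ?thesis
    by (rule that)
qed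

lemma has_form_unique:
  assumes "n > 0" "has_form n (x::'a) G" "has_form n x H"
  shows "[G = H] (mod cyc n)"
proof -
  have "gf2_embed (tau n (f * (G + H))) = (0::'a)" for f
    using assms unfolding has_form_def distrib_left tau_add gf2_embed_add by (metis double)
  then have "cyc n dvd G + H"
    by (intro tau_nondegenerate[OF assms(1)]) (simp add: gf2_embed_eq_0_iff)
  then show ?thesis
    by (simp add: cong_iff_dvd_diff gf2_poly_diff)
qed

text \<open>The trace form is symmetric and \<open>star\<close> is the adjoint, so
  \<open>star n G\<close> represents the same form.\<close>

lemma has_form_star:
  assumes "n > 0" "has_form n (x::'a) G"
  shows "[star n G = G] (mod cyc n)"
proof (rule has_form_unique[OF assms(1) _ assms(2)])
  have x: "x \<in> fixed n" using assms(2) by (simp add: has_form_def)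
  show "has_form n x (star n G)"
    unfolding has_form_def
  proof (intro conjI allI x)
    fix f
    have "field_trace n (x * act f x) = field_trace n (x * act (star n f) x)"
      using trace_adjoint[OF x x assms(1), of f] by (simp add: mult.commute)
    also have "\<dots> = gf2_embed (tau n (star n f * G))"
      using assms(2) by (simp add: has_form_def)
    also have "tau n (star n f * G) = tau n (star n (star n f * G))"
      by (simp add: tau_star assms(1))
    also have "\<dots> = tau n (f * star n G)"
      unfolding star_mult by (intro tau_cong cong_scalar_right star_star assms(1))
    finally show "field_trace n (x * act f x) = gf2_embed (tau n (f * star n G))" .
  qed
qed

lemma has_form_cong:
  assumes "has_form n (x::'a) G" "[G = H] (mod cyc n)"
  shows "has_form n x H"
  using assms tau_cong[OF cong_scalar_left[OF assms(2)]] by (simp add: has_form_def)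

text \<open>Adjointness moves \<open>g\<close> across the product. Prescribing a form thus becomes
  the question of which elements are norms.\<close>

lemma has_form_act:
  assumes "n > 0" "has_form n (x::'a) G"
  shows "has_form n (act g x) (g * star n g * G)"
  unfolding has_form_def
proof (intro conjI allI)
  have x: "x \<in> fixed n" using assms(2) by (simp add: has_form_def)
  then show "act g x \<in> fixed n"
    by (rule act_in_fixed)
  fix f
  have "field_trace n (act g x * act f (act g x)) = field_trace n (x * act (star n g) (act f (act g x)))"
    by (intro trace_adjoint act_in_fixed x assms)
  also have "\<dots> = field_trace n (x * act (star n g * (f * g)) x)"
    by (simp add: act_mult)
  also have "\<dots> = gf2_embed (tau n (star n g * (f * g) * G))"
    using assms(2) by (simp add: has_form_def)
  finally show "field_trace n (act g x * act f (act g x)) = gf2_embed (tau n (f * (g * star n g * G)))"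
    by (simp add: algebra_simps)
qed

text \<open>If \<open>f\<close> annihilates \<open>x\<close>, then \<open>f * G\<close> is
  orthogonal under \<open>tau\<close> to all powers of \<open>x\<close>, hence zero, and the unit
  \<open>G\<close> cancels.\<close>

lemma generatorI_form:
  assumes "n > 0" "has_form n (x::'a) G" "[G * G' = 1] (mod cyc n)"
  shows "generator n x"
  unfolding generator_def
proof (intro conjI allI impI)
  show "x \<in> fixed n" using assms(2) by (simp add: has_form_def)
  fix f assume f: "act f x = 0"
  have "tau n (xp k * (f * G)) = 0" for k
  proof -
    have "gf2_embed (tau n (xp k * f * G)) = field_trace n (x * act (xp k * f) x)"
      using assms(2) by (simp add: has_form_def)
    also have "\<dots> = 0"
      by (simp add: act_mult f)
    finally show ?thesis
      by (simp add: gf2_embed_eq_0_iff mult.assoc)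
  qed
  then have "cyc n dvd f * G"
    by (intro tau_nondegenerate assms(1))
  then have "cyc n dvd f * (G * G')"
    by (simp add: mult.assoc[symmetric])
  moreover have "[f * (G * G') = f * 1] (mod cyc n)"
    by (intro cong_scalar_left assms(3))
  ultimately show "cyc n dvd f"
    by (simp add: cong_dvd_iff)
qed

text \<open>Sets of exponents are polynomials over \<open>GF(2)\<close> of degree below
  \<open>n\<close>; two equal sums would give a nonzero annihilator of too small a degree.\<close>

lemma generator_inj:
  assumes "n > 0" "generator n (x::'a)"
  shows "inj_on (\<lambda>S. \<Sum>i\<in>S. x ^ (2 ^ i)) (Pow {..<n})"
proof (rule inj_onI)
  fix S T assume ST: "S \<in> Pow {..<n}" "T \<in> Pow {..<n}"
    and eq: "(\<Sum>i\<in>S. x ^ (2 ^ i)) = (\<Sum>i\<in>T. x ^ (2 ^ i))"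
  have fin: "finite S" "finite T"
    using ST finite_subset by auto
  define f where "f = (\<Sum>i\<in>S. xp i) + (\<Sum>i\<in>T. xp i)"
  have coeff: "coeff f i = (if i \<in> S then 1 else 0) + (if i \<in> T then 1 else 0)" for i
    using fin by (simp add: f_def coeff_sum)
  have "act f x = 0"
    by (simp add: f_def act_add act_sum act_xp eq double)
  then have "cyc n dvd f"
    using assms(2) by (simp add: generator_def)
  moreover have "degree f < n"
  proof -
    have "degree f \<le> n - 1"
      by (rule degree_le) (use ST assms(1) in \<open>auto simp: coeff\<close>)
    then show ?thesis using assms(1) by simp
  qed
  ultimately have "f = 0"
    using assms(1) by (metis degree_cyc dvd_imp_degree_le leD)
  then show "S = T"
  proof -
    have "i \<in> S \<longleftrightarrow> i \<in> T" for i
      using coeff[of i] \<open>f = 0\<close> by (auto split: if_splits)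
    then show ?thesis by blast
  qed
qed

text \<open>The \<open>2 ^ n\<close> distinct subset sums exhaust \<open>fixed n\<close>, which has
  at most that many elements.\<close>

lemma generator_surj:
  assumes "n > 0" "generator n (x::'a)"
  shows "(\<lambda>S. \<Sum>i\<in>S. x ^ (2 ^ i)) ` Pow {..<n} = fixed n"
proof (rule card_seteq)
  have x: "x \<in> fixed n"
    using assms(2) by (simp add: generator_def)
  show "(\<lambda>S. \<Sum>i\<in>S. x ^ (2 ^ i)) ` Pow {..<n} \<subseteq> fixed n"
    using act_in_fixed[OF x, of "\<Sum>i\<in>S. xp i" for S] by (auto simp: act_sum act_xp)
  show "card (fixed n :: 'a set) \<le> card ((\<lambda>S. \<Sum>i\<in>S. x ^ (2 ^ i)) ` Pow {..<n})"
    using card_image[OF generator_inj[OF assms]] card_fixed_le[OF assms(1)] by (simp add: card_Pow)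
qed simp

text \<open>Let \<open>q\<close> be the cofactor of the gcd \<open>d\<close> in
  \<open>cyc n\<close>. As \<open>cyc n\<close> divides \<open>q * G\<close>, the element
  \<open>act q x\<close> is orthogonal to the whole subfield, so it is 0; then \<open>cyc n\<close>
  divides \<open>q\<close> and \<open>d\<close> is a unit.\<close>

lemma generator_form_invertible:
  assumes N: "N = n * k" and n: "n > 0" and gen: "generator n (x::'a)" and form: "has_form n x G"
  obtains G' where "[G * G' = 1] (mod cyc n)"
proof -
  have x: "x \<in> fixed n"
    using gen by (simp add: generator_def)
  define d where "d = gcd G (cyc n)"
  obtain q where q: "cyc n = d * q"
    using d_def by (metis dvdE gcd_dvd2)
  obtain p where p: "G = d * p"
    using d_def by (metis dvdE gcd_dvd1)
  define z where "z = act q x"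
  have z: "z \<in> fixed n"
    unfolding z_def by (rule act_in_fixed[OF x])
  have orth: "field_trace n (act f x * z) = 0" for f
  proof -
    have "field_trace n (act f x * z) = field_trace n (x * act (star n f) z)"
      by (rule trace_adjoint[OF x z n])
    also have "\<dots> = field_trace n (x * act (star n f * q) x)"
      by (simp add: z_def act_mult)
    also have "\<dots> = gf2_embed (tau n (star n f * q * G))"
      using form by (simp add: has_form_def)
    also have "star n f * q * G = cyc n * (star n f * p)"
      by (simp add: q p algebra_simps)
    also have "tau n \<dots> = tau n 0"
      by (intro tau_cong) (simp add: cong_0_iff)
    finally show ?thesis by simp
  qed
  have "z = 0"
  proof (rule ccontr)
    assume "z \<noteq> 0"
    \<comment> \<open>Nondegeneracy of the trace: \<open>y / z\<close> is reached from the
      generator, and its product with \<open>z\<close> has nonzero trace.\<close>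
    obtain y :: 'a where y: "y \<in> fixed n" "field_trace n y \<noteq> 0"
      using trace_one[OF N n] by (metis zero_neq_one)
    have "y / z \<in> fixed n"
      using y z by (simp add: fixed_def power_divide)
    then obtain S where "y / z = (\<Sum>i\<in>S. x ^ (2 ^ i))"
      using generator_surj[OF n gen] by blast
    then have "y / z = act (\<Sum>i\<in>S. xp i) x"
      by (simp add: act_sum act_xp)
    then show False
      using orth[of "\<Sum>i\<in>S. xp i"] \<open>z \<noteq> 0\<close> y(2) by (metis nonzero_divide_eq_eq)
  qed
  then have "cyc n dvd q"
    using gen by (simp add: generator_def z_def)
  then have "is_unit d"
    using q cyc_nonzero[OF n]
    by (metis dvd_mult_cancel_right dvd_refl mult.left_neutral mult_eq_0_iff dvd_trans)
  then have "gcd G (cyc n) = 1"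
    unfolding d_def by (metis is_unit_gcd_iff)
  then show ?thesis
    by (rule coprime_invertible) (rule that)
qed

end

section \<open>Existence of generators in odd degree\<close>

lemma degree_gf2_dvd_less:
  assumes "p * q = cyc n" "n > 0" "degree p > 0"
  shows "q \<noteq> 0" "degree q < n"
proof -
  have "p \<noteq> 0" "q \<noteq> 0"
    using assms cyc_nonzero by (metis mult_zero_left, metis mult_zero_right)
  then show "q \<noteq> 0" "degree q < n"
    using assms degree_mult_eq[of p q] degree_cyc[of n] by simp_all
qed

text \<open>A repeated factor divides the derivative \<open>xp (n - 1)\<close>, hence both
  \<open>xp n\<close> and \<open>cyc n\<close>, whose difference is 1.\<close>

lemma squarefree_cyc:
  assumes "odd n" "p ^ 2 dvd cyc n"
  shows "is_unit p"
proof -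
  obtain h where h: "cyc n = p * (p * h)"
    using assms(2) by (metis dvdE mult.assoc power2_eq_square)
  then have "p dvd pderiv (cyc n)"
    by (simp add: pderiv_mult)
  moreover have "pderiv (cyc n) = xp (n - 1)"
  proof -
    obtain l where "n = 2 * l + 1"
      using assms(1) by (rule oddE)
    then show ?thesis
      by (simp add: cyc_def pderiv_diff pderiv_monom)
  qed
  ultimately have "p dvd xp 1 * xp (n - 1)"
    by simp
  also have "xp 1 * xp (n - 1) = xp n"
    using assms(1) by (cases n) (simp_all add: mult_monom)
  finally have "p dvd xp n - cyc n"
    using h by (intro dvd_diff) simp_all
  then show ?thesis
    by (simp add: cyc_def)
qed

context gf2_extension
begin

lemma generator_exists:
  assumes N: "N = n * k" and "odd n"
  obtains x :: 'a where "generator n x"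
proof -
  have n: "n > 0"
    using \<open>odd n\<close> by (cases n) auto
  \<comment> \<open>Elements with annihilators generated by coprime polynomials add up to an element whose
    annihilator is generated by their product.\<close>
  have "\<exists>x::'a. x \<in> fixed n \<and> act d x = 0 \<and> (\<forall>f. act f x = 0 \<longrightarrow> d dvd f)" if "d dvd cyc n" for d
    using that
  proof (induction "degree d" arbitrary: d rule: less_induct)
    case less
    show ?case
    proof (cases "is_unit d")
      case True
      then have "d dvd f" for f
        by (rule unit_imp_dvd)
      then show ?thesis
        by (intro exI[of _ 0]) (simp add: fixed_def power_0_left)
    next
      case False
      have d0: "d \<noteq> 0"
        using less.prems cyc_nonzero[OF n] by auto
      then obtain p where p: "prime_elem p" "p dvd d"
        using False prime_divisor_exists by (metis prime_def)
      then obtain e where e: "d = p * e" by auto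
      have deg_p: "degree p > 0"
        using p(1) by (metis gr0I is_unit_iff_degree prime_elem_def)
      have "p \<noteq> 0" "e \<noteq> 0"
        using d0 e by auto
      then have "degree e < degree d"
        using deg_p by (simp add: e degree_mult_eq)
      moreover have "e dvd cyc n"
        using less.prems e dvd_mult_right by blast
      ultimately obtain y :: 'a where y: "y \<in> fixed n" "act e y = 0" "\<And>f. act f y = 0 \<Longrightarrow> e dvd f"
        using less.hyps by blast
      have "\<not> p dvd e"
      proof
        assume "p dvd e"
        then have "p ^ 2 dvd d"
          by (simp add: e power2_eq_square)
        then have "p ^ 2 dvd cyc n"
          using less.prems dvd_trans by blast
        then show False
          using squarefree_cyc[OF \<open>odd n\<close>] p(1) by (auto simp: prime_elem_def)
      qed
      have coprime: "coprime p f" if "\<not> p dvd f" for f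
        using prime_elem_imp_coprime[OF p(1) that] .
      obtain q where q: "cyc n = p * q"
        using less.prems e by (metis dvdE mult.assoc)
      obtain z :: 'a where z: "z \<in> fixed n" "act q z \<noteq> 0"
        using lift_fixed[OF N n degree_gf2_dvd_less[OF q[symmetric] n deg_p]] by blast
      \<comment> \<open>A nonzero element killed by the prime \<open>p\<close>; by Bezout its
        annihilator is generated by \<open>p\<close>.\<close>
      define w where "w = act q z"
      have w: "w \<in> fixed n" "w \<noteq> 0" "act p w = 0"
        using z act_in_fixed[OF z(1)] fixed_iff_act[of z n] by (simp_all add: w_def q act_mult)
      have w_dvd: "p dvd f" if "act f w = 0" for f
      proof (rule ccontr)
        assume "\<not> p dvd f"
        then have "gcd p f = 1"
          using coprime by (simp add: coprime_iff_gcd_eq_1)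
        then obtain a b where "a * p + b * f = 1"
          using bezout_coefficients_fst_snd by metis
        then have "w = act (a * p + b * f) w"
          by simp
        then show False
          using that w by (simp add: act_add act_mult)
      qed
      have "e * p dvd f" if f: "act f (y + w) = 0" for f
      proof -
        have sum: "act f y + act f w = 0"
          using f by (simp add: act_add_right)
        \<comment> \<open>Multiplying by \<open>e\<close> kills the \<open>y\<close> part and
          isolates \<open>w\<close>; below, multiplying by \<open>p\<close> isolates
          \<open>y\<close>.\<close>
        have "act (e * f) w = act e (act f y + act f w)"
          using y(2) by (metis act_add_right act_mult act_0_right add_0 mult.commute)
        then have "p dvd e * f"
          using sum by (intro w_dvd) simp
        then have "p dvd f"
          using \<open>\<not> p dvd e\<close> p(1) by (simp add: prime_elem_dvd_mult_iff)
        have "act (p * f) y = act p (act f y + act f w)"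
          using w(3) by (metis act_add_right act_mult act_0_right add_0_right mult.commute)
        then have "e dvd p * f"
          using sum by (intro y(3)) simp
        then have "e dvd f"
          using coprime[OF \<open>\<not> p dvd e\<close>] by (simp add: coprime_commute coprime_dvd_mult_right_iff)
        with \<open>p dvd f\<close> show ?thesis
          using coprime[OF \<open>\<not> p dvd e\<close>] by (intro divides_mult) (simp_all add: coprime_commute)
      qed
      moreover have "act d (y + w) = 0"
        using y(2) w(3) by (metis act_add_right act_mult act_0_right add_0_right e mult.commute)
      ultimately show ?thesis
        using add_in_fixed[OF y(1) w(1)] by (metis e mult.commute)
    qed
  qed
  from this[of "cyc n"] that show thesis
    by (auto simp: generator_def)
qed

text \<open>By the Chinese remainder theorem the pairs of residues run once through all index pairs,
  so the sum factors.\<close>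

lemma trace_mult_coprime:
  assumes nm: "coprime n m" "n > 0" "m > 0" and u: "u \<in> fixed n" and v: "v \<in> (fixed m :: 'a set)"
  shows "field_trace (n * m) (u * v) = field_trace n u * field_trace m v"
proof -
  let ?c = "\<lambda>k. (k mod n, k mod m)"
  have inj: "inj_on ?c {..<n * m}"
  proof (rule inj_onI)
    fix i j assume ij: "i \<in> {..<n * m}" "j \<in> {..<n * m}" "?c i = ?c j"
    then have "[i = j] (mod n * m)"
      using nm(1) by (intro coprime_cong_mult_nat) (simp_all add: cong_def)
    with ij show "i = j"
      by (simp add: cong_def)
  qed
  have "?c ` {..<n * m} = {..<n} \<times> {..<m}"
    by (rule card_seteq) (use nm in \<open>auto simp: card_image[OF inj]\<close>)
  then have "field_trace n u * field_trace m v
      = (\<Sum>(i, j)\<in>?c ` {..<n * m}. u ^ (2 ^ i) * v ^ (2 ^ j))"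
    by (simp add: field_trace_def sum_product sum.cartesian_product)
  also have "\<dots> = (\<Sum>k<n * m. u ^ (2 ^ (k mod n)) * v ^ (2 ^ (k mod m)))"
    by (simp add: sum.reindex[OF inj])
  also have "\<dots> = (\<Sum>k<n * m. (u * v) ^ (2 ^ k))"
  proof (rule sum.cong[OF refl])
    fix k
    have "u ^ (2 ^ (k mod n)) = u ^ (2 ^ k)" "v ^ (2 ^ (k mod m)) = v ^ (2 ^ k)"
      using frobenius_cong[OF u, of "k mod n" k] frobenius_cong[OF v, of "k mod m" k]
      by (simp_all add: cong_def)
    then show "u ^ (2 ^ (k mod n)) * v ^ (2 ^ (k mod m)) = (u * v) ^ (2 ^ k)"
      by (simp add: power_mult_distrib)
  qed
  finally show ?thesis
    by (simp add: field_trace_def)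
qed

end

text \<open>The substitutions by the Chinese remainder exponents \<open>e1\<close> and
  \<open>e2\<close> embed the two group algebras as tensor factors of the one of order
  \<open>n * m\<close>; on monomials the claim is a divisibility test in each factor.\<close>

lemma tau_mult_coprime:
  assumes nm: "coprime n m" "n > 0" "m > 0"
    and e1: "[e1 = 1] (mod n)" "[e1 = 0] (mod m)" and e2: "[e2 = 0] (mod n)" "[e2 = 1] (mod m)"
  shows "tau (n * m) (xp k * (A \<circ>\<^sub>p xp e1 * B \<circ>\<^sub>p xp e2)) = tau n (xp k * A) * tau m (xp k * B)"
proof (induction A rule: gf2_poly_induct)
  case (xp i)
  show ?case
  proof (induction B rule: gf2_poly_induct)
    case (xp j)
    have "n * m dvd k + (i * e1 + j * e2) \<longleftrightarrow>
        [k + (i * e1 + j * e2) = 0] (mod n) \<and> [k + (i * e1 + j * e2) = 0] (mod m)"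
      using nm(1) by (auto simp: cong_0_iff intro: divides_mult dvd_mult_left dvd_mult_right)
    also have "[k + (i * e1 + j * e2) = 0] (mod n) \<longleftrightarrow> n dvd k + i"
    proof -
      have "[k + (i * e1 + j * e2) = k + (i * 1 + j * 0)] (mod n)"
        by (intro cong_add cong_scalar_left e1 e2 cong_refl)
      then show ?thesis
        by (simp add: cong_0_iff cong_dvd_iff)
    qed
    also have "[k + (i * e1 + j * e2) = 0] (mod m) \<longleftrightarrow> m dvd k + j"
    proof -
      have "[k + (i * e1 + j * e2) = k + (i * 0 + j * 1)] (mod m)"
        by (intro cong_add cong_scalar_left e1 e2 cong_refl)
      then show ?thesis
        by (simp add: cong_0_iff cong_dvd_iff)
    qed
    finally show ?case
      using nm by (simp add: pcompose_xp mult_monom tau_xp)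
  qed (simp_all add: pcompose_add distrib_left tau_add)
qed (simp_all add: pcompose_add distrib_left distrib_right tau_add)

context gf2_extension
begin

text \<open>The form of \<open>u * v\<close> is the product of the embedded forms, inverted by the
  product of the embedded inverses.\<close>

lemma generator_mult_coprime:
  assumes nm: "coprime n m" "n > 0" "m > 0"
    and u: "has_form n (u::'a) A" "[A * A' = 1] (mod cyc n)"
    and v: "has_form m v B" "[B * B' = 1] (mod cyc m)"
  shows "generator (n * m) (u * v)"
proof -
  obtain e1 where e1: "[e1 = 1] (mod n)" "[e1 = 0] (mod m)"
    using binary_chinese_remainder_nat[OF nm(1)] by blast
  obtain e2 where e2: "[e2 = 0] (mod n)" "[e2 = 1] (mod m)"
    using binary_chinese_remainder_nat[OF nm(1)] by blast
  have uv: "u \<in> fixed n" "v \<in> fixed m"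
    using u v by (simp_all add: has_form_def)
  have fixed_mult: "x \<in> fixed n \<Longrightarrow> x \<in> fixed (n * m)" "x \<in> fixed m \<Longrightarrow> x \<in> fixed (n * m)" for x :: 'a
    unfolding fixed_def mem_Collect_eq
    using frobenius_cong[of x n "n * m" 0] frobenius_cong[of x m "n * m" 0]
    by (simp_all add: fixed_def cong_def)
  let ?C = "A \<circ>\<^sub>p xp e1 * B \<circ>\<^sub>p xp e2"
  let ?C' = "A' \<circ>\<^sub>p xp e1 * B' \<circ>\<^sub>p xp e2"
  have "has_form (n * m) (u * v) ?C"
  proof (rule has_formI)
    show "u * v \<in> fixed (n * m)"
      by (intro mult_in_fixed fixed_mult uv)
    fix k
    have "u * v * (u * v) ^ (2 ^ k) = (u * u ^ (2 ^ k)) * (v * v ^ (2 ^ k))"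
      by (simp add: power_mult_distrib)
    also have "field_trace (n * m) \<dots> = field_trace n (u * u ^ (2 ^ k)) * field_trace m (v * v ^ (2 ^ k))"
      by (intro trace_mult_coprime nm mult_in_fixed frobenius_in_fixed uv)
    also have "\<dots> = field_trace n (u * act (xp k) u) * field_trace m (v * act (xp k) v)"
      by (simp add: act_xp)
    also have "\<dots> = gf2_embed (tau n (xp k * A)) * gf2_embed (tau m (xp k * B))"
      using u(1) v(1) by (simp add: has_form_def)
    also have "\<dots> = gf2_embed (tau (n * m) (xp k * ?C))"
      unfolding tau_mult_coprime[OF nm e1 e2] gf2_embed_mult ..
    finally show "field_trace (n * m) (u * v * (u * v) ^ (2 ^ k)) = gf2_embed (tau (n * m) (xp k * ?C))" .
  qed
  moreover have "[?C * ?C' = 1] (mod cyc (n * m))"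
  proof -
    have "?C * ?C' = ((A * A') \<circ>\<^sub>p xp e1) * ((B * B') \<circ>\<^sub>p xp e2)"
      by (simp add: pcompose_mult algebra_simps)
    also have "[\<dots> = (1 \<circ>\<^sub>p xp e1) * (1 \<circ>\<^sub>p xp e2)] (mod cyc (n * m))"
    proof (intro cong_mult)
      \<comment> \<open>As \<open>m\<close> divides \<open>e1\<close>, the substitution carries the
        modulus \<open>cyc n\<close> to a multiple of \<open>cyc (n * m)\<close>.\<close>
      show "[(A * A') \<circ>\<^sub>p xp e1 = 1 \<circ>\<^sub>p xp e1] (mod cyc (n * m))"
        using e1(2) by (intro cong_pcompose_xp[OF u(2)]) (simp add: cong_0_iff)
      show "[(B * B') \<circ>\<^sub>p xp e2 = 1 \<circ>\<^sub>p xp e2] (mod cyc (n * m))"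
        using e2(1) by (intro cong_pcompose_xp[OF v(2)]) (simp add: cong_0_iff mult.commute)
    qed
    finally show ?thesis
      by (simp add: pcompose_1)
  qed
  ultimately show ?thesis
    using nm by (intro generatorI_form) simp_all
qed

text \<open>Linear combinations over \<open>GF(2)\<close> are subset sums: their injectivity gives
  independence, their surjectivity gives spanning.\<close>

lemma generator_imp_normal:
  assumes "generator N (x::'a)"
  shows "normal_element N x"
proof -
  interpret V: vector_space "gf2_scale :: gf2 \<Rightarrow> 'a \<Rightarrow> 'a"
    by (rule vector_space_gf2_scale[OF card_field N_pos])
  define e where "e i = x ^ (2 ^ i)" for i
  have B: "{x ^ (2 ^ i) | i. i < N} = e ` {..<N}"
    by (auto simp: e_def)
  have inj: "inj_on (\<lambda>S. \<Sum>i\<in>S. e i) (Pow {..<N})"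
    using generator_inj[OF N_pos assms] by (simp add: e_def)
  have inj_e: "inj_on e {..<N}"
  proof (rule inj_onI)
    fix i j assume "i \<in> {..<N}" "j \<in> {..<N}" "e i = e j"
    then show "i = j"
      using inj_onD[OF inj, of "{i}" "{j}"] by simp
  qed
  have "V.independent (e ` {..<N})"
  proof (rule V.independent_if_scalars_zero)
    fix f b assume sum: "(\<Sum>b\<in>e ` {..<N}. gf2_scale (f b) b) = 0" and b: "b \<in> e ` {..<N}"
    define S where "S = {i \<in> {..<N}. f (e i) \<noteq> 0}"
    have "0 = (\<Sum>i<N. gf2_scale (f (e i)) (e i))"
      using sum by (simp add: sum.reindex[OF inj_e])
    also have "\<dots> = (\<Sum>i\<in>S. gf2_scale (f (e i)) (e i))"
      by (rule sum.mono_neutral_right) (auto simp: S_def gf2_scale_def)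
    also have "\<dots> = (\<Sum>i\<in>S. e i)"
    proof (rule sum.cong[OF refl])
      fix i assume "i \<in> S"
      then show "gf2_scale (f (e i)) (e i) = e i"
        using gf2_cases[of "f (e i)"] by (auto simp: S_def gf2_scale_def)
    qed
    finally have "S = {}"
      using inj_onD[OF inj, of S "{}"] by (auto simp: S_def)
    then show "f b = 0"
      using b by (auto simp: S_def)
  qed simp
  moreover have "V.span (e ` {..<N}) = UNIV"
  proof -
    have "y \<in> V.span (e ` {..<N})" for y
    proof -
      have "y \<in> (\<lambda>S. \<Sum>i\<in>S. e i) ` Pow {..<N}"
        using generator_surj[OF N_pos assms] fixed_N[of y] by (simp add: e_def)
      then obtain S where S: "y = (\<Sum>i\<in>S. e i)" "S \<subseteq> {..<N}"
        by auto
      show ?thesis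
        unfolding S(1) by (intro V.span_sum V.span_base) (use S(2) in auto)
    qed
    then show ?thesis
      by auto
  qed
  ultimately show ?thesis
    by (simp add: normal_element_def B)
qed

end

subsection \<open>Elements with prescribed trace forms\<close>

text \<open>The two remainders are both 0 or add up to \<open>n\<close>, so an entry depends on its
  index only up to sign modulo \<open>n\<close>.\<close>

lemma symmetric_vector_neg:
  assumes "symmetric_vector n u" "n > 0" "[i + j = 0] (mod n)"
  shows "u (i mod n) = u (j mod n)"
proof -
  have "n dvd i mod n + j mod n"
    using assms(3) by (simp add: cong_def mod_add_eq dvd_eq_mod_eq_0)
  then obtain q where q: "i mod n + j mod n = n * q" ..
  have less: "i mod n < n" "j mod n < n"
    using assms(2) by simp_all
  then have "n * q < n * 2"
    using q by linarith
  then consider "q = 0" | "q = 1"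
    by fastforce
  then show ?thesis
  proof cases
    case 1
    then show ?thesis using q by simp
  next
    case 2
    then have sum: "i mod n + j mod n = n"
      using q by simp
    have "i mod n = n - j mod n"
      using sum by linarith
    moreover have "1 \<le> j mod n \<and> j mod n \<le> n - 1"
      using sum less by linarith
    ultimately show ?thesis
      using assms(1) unfolding symmetric_vector_def by metis
  qed
qed

text \<open>\<open>tau\<close> picks the entry at \<open>-k\<close>, which symmetry identifies with
  the one at \<open>k\<close>.\<close>

lemma tau_symmetric_vector:
  assumes "symmetric_vector n u" "n > 0"
  shows "tau n (xp k * (\<Sum>j<n. monom (u j) j)) = u (k mod n)"
proof -
  define i where "i = k * (n - 1) mod n"
  have k: "k * (n - 1) + k = n * k"
    using assms(2) by (cases n) simp_all
  have "n dvd k + j \<longleftrightarrow> j = i" if "j < n" for j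
  proof -
    have "n dvd k + j \<longleftrightarrow> [k * (n - 1) + (k + j) = k * (n - 1) + 0] (mod n)"
      unfolding cong_add_lcancel_nat cong_0_iff ..
    also have "k * (n - 1) + (k + j) = n * k + j"
      using k by simp
    also have "[n * k + j = k * (n - 1) + 0] (mod n) \<longleftrightarrow> j = i"
      using that by (simp add: cong_def i_def)
    finally show ?thesis .
  qed
  then have *: "u j * tau n (xp (k + j)) = (if j = i then u i else 0)" if "j < n" for j
    using that assms(2) by (simp add: tau_xp)
  have "xp k * (\<Sum>j<n. monom (u j) j) = (\<Sum>j<n. smult (u j) (xp (k + j)))"
    by (simp add: sum_distrib_left mult_monom smult_monom)
  then have "tau n (xp k * (\<Sum>j<n. monom (u j) j)) = (\<Sum>j<n. u j * tau n (xp (k + j)))"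
    by (simp only: tau_sum tau_smult)
  also have "\<dots> = (\<Sum>j<n. if j = i then u i else 0)"
    by (intro sum.cong refl) (simp add: *)
  also have "\<dots> = u i"
    using assms(2) by (simp add: i_def)
  also have "u i = u (k mod n)"
    unfolding i_def using k by (intro symmetric_vector_neg assms) (simp add: cong_def)
  finally show ?thesis .
qed

lemma symmetric_vector_star:
  assumes "symmetric_vector n u" "n > 0"
  shows "[star n (\<Sum>j<n. monom (u j) j) = (\<Sum>j<n. monom (u j) j)] (mod cyc n)"
proof -
  let ?A = "\<Sum>j<n. monom (u j) j"
  have "tau n (xp k * (star n ?A + ?A)) = 0" for k
  proof -
    have "tau n (xp k * star n ?A) = tau n (star n (xp k * star n ?A))"
      by (simp add: tau_star assms(2))
    also have "\<dots> = tau n (xp (k * (n - 1)) * ?A)"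
      unfolding star_mult star_xp by (intro tau_cong cong_scalar_left star_star assms)
    also have "\<dots> = u (k * (n - 1) mod n)"
      by (rule tau_symmetric_vector[OF assms])
    also have "\<dots> = u (k mod n)"
    proof (intro symmetric_vector_neg assms)
      have "k * (n - 1) + k = n * k"
        using assms(2) by (cases n) simp_all
      then show "[k * (n - 1) + k = 0] (mod n)"
        by (simp add: cong_def)
    qed
    finally show ?thesis
      by (simp add: distrib_left tau_add tau_symmetric_vector[OF assms] flip: mult_2)
  qed
  then have "cyc n dvd star n ?A + ?A"
    by (intro tau_nondegenerate assms)
  then show ?thesis
    by (simp add: cong_iff_dvd_diff gf2_poly_diff)
qed

lemma hermitian_one_symmetric_vector:
  assumes "symmetric_vector (2 * h) u" "h > 0" "u 0 = 1" "u h = 0"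
  shows "hermitian_one (2 * h) (\<Sum>k<2 * h. monom (u k) k)"
  using symmetric_vector_cong[OF assms(1,2)] assms(3,4)
  by (auto simp: hermitian_one_def one_pCons)

text \<open>The sum of the entries at odd indices is the derivative at 1 of the lower half
  \<open>W\<close> of the polynomial.\<close>

lemma symmetric_vector_cong_4:
  assumes "symmetric_vector (2 * h) u" "h > 0" "u 0 = 1" "u h = 0" "even h"
    and "(\<Sum>i\<in>{0<..<h}. if odd i then u i else 0) = 1"
  shows "[(\<Sum>k<2 * h. monom (u k) k) = 1 + xp 1 + xp 3] (mod cyc 4)"
proof -
  let ?W = "\<Sum>k\<in>{0<..<h}. monom (u k) k"
  have dvd: "4 dvd 2 * h"
    using \<open>even h\<close> by auto
  have "[(\<Sum>k<2 * h. monom (u k) k) = 1 + ?W + star (2 * h) ?W] (mod cyc (2 * h))"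
    using symmetric_vector_cong[OF assms(1,2)] assms(3,4) by (simp add: one_pCons)
  then have "[(\<Sum>k<2 * h. monom (u k) k) = 1 + ?W + star (2 * h) ?W] (mod cyc 4)"
    using cong_dvd_modulus cyc_dvd[OF dvd] by blast
  also have "[1 + ?W + star (2 * h) ?W = 1 + ?W + star 4 ?W] (mod cyc 4)"
    using assms(2) by (intro cong_add star_cong_dvd dvd cong_refl) simp
  also have "1 + ?W + star 4 ?W = 1 + (?W + star 4 ?W)"
    by (rule add.assoc)
  also have "[1 + (?W + star 4 ?W) = 1 + smult (poly (pderiv ?W) 1) (xp 1 + xp 3)] (mod cyc 4)"
    by (intro cong_add cong_add_star_pderiv cong_refl)
  also have "poly (pderiv ?W) 1 = (\<Sum>i\<in>{0<..<h}. if odd i then u i else 0)"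
  proof -
    have "of_nat i * u i = (if odd i then u i else 0)" for i
      by (auto elim!: evenE oddE)
    then show ?thesis
      by (simp add: poly_sum pderiv_sum pderiv_monom poly_monom)
  qed
  finally show ?thesis
    by (simp add: assms(6) add.assoc)
qed

text \<open>Modulo \<open>cyc 4\<close> only two residues are possible, according to the derivative
  of \<open>W\<close> at 1.\<close>

lemma hermitian_one_cong_4:
  assumes "hermitian_one n U" "4 dvd n" "n > 0" "\<not> [U = 1] (mod cyc 4)"
  shows "[U = 1 + xp 1 + xp 3] (mod cyc 4)"
proof -
  obtain W where W: "[U = 1 + W + star 4 W] (mod cyc 4)"
    using hermitian_one_dvd[OF assms(2,3,1)] by (auto simp: hermitian_one_def)
  note W
  also have "1 + W + star 4 W = 1 + (W + star 4 W)"
    by (rule add.assoc)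
  also have "[1 + (W + star 4 W) = 1 + smult (poly (pderiv W) 1) (xp 1 + xp 3)] (mod cyc 4)"
    by (intro cong_add cong_add_star_pderiv cong_refl)
  finally show ?thesis
    using gf2_cases[of "poly (pderiv W) 1"] assms(4) by (auto simp: add.assoc)
qed

context gf2_extension
begin

lemma trace_symmetric_vector:
  assumes "symmetric_vector n u" "n > 0" "has_form n (x::'a) (\<Sum>j<n. monom (u j) j)"
  shows "field_trace n (x * x ^ (2 ^ k)) = gf2_embed (u (k mod n))"
  using assms(3) unfolding has_form_def
  by (metis act_xp tau_symmetric_vector[OF assms(1,2)])

text \<open>From a generator with form \<open>G\<close>, the form \<open>B\<close> is reached
  through a norm equal to \<open>U = B / G\<close>. This \<open>U\<close> is symmetric, and a
  symmetric square root \<open>V\<close> of it satisfies \<open>V * star m V = U\<close>.\<close>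

lemma odd_form_exists:
  assumes N: "N = m * k" and "odd m"
    and star_B: "[star m B = B] (mod cyc m)"
  obtains x :: 'a where "has_form m x B"
proof -
  have m: "m > 0"
    using \<open>odd m\<close> by (cases m) auto
  obtain x :: 'a where gen: "generator m x"
    using generator_exists[OF N \<open>odd m\<close>] by blast
  then obtain G where G: "has_form m x G"
    using form_exists[of x m] m by (auto simp: generator_def)
  obtain G' where G': "[G * G' = 1] (mod cyc m)"
    using generator_form_invertible[OF N m gen G] by blast
  have star_G': "[star m G' = G'] (mod cyc m)"
  proof -
    have "[star m G' = star m G' * (G * G')] (mod cyc m)"
      using cong_scalar_left[OF cong_sym[OF G']] by (metis mult_1_right)
    also have "star m G' * (G * G') = G * (star m G' * G')"
      by (simp add: ac_simps)
    also have "[G * (star m G' * G') = star m G * (star m G' * G')] (mod cyc m)"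
      by (intro cong_scalar_right cong_sym[OF has_form_star[OF m G]])
    also have "star m G * (star m G' * G') = star m (G * G') * G'"
      by (simp add: star_mult ac_simps)
    also have "[star m (G * G') * G' = star m 1 * G'] (mod cyc m)"
      by (intro cong_scalar_right star_cong G')
    finally show ?thesis
      by simp
  qed
  define U where "U = B * G'"
  have star_U: "[star m U = U] (mod cyc m)"
    unfolding U_def star_mult by (intro cong_mult star_B star_G')
  \<comment> \<open>The inverse of 2 modulo \<open>m\<close>.\<close>
  define d where "d = (m + 1) div 2"
  have d: "d * 2 = m + 1"
    unfolding d_def using \<open>odd m\<close> by (intro dvd_div_mult_self) simp
  \<comment> \<open>Squaring permutes the exponents modulo the odd number \<^term>\<open>m\<close>, and so has an inverse.\<close>
  define V where "V = U \<circ>\<^sub>p xp d"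
  have V2: "[V * V = U] (mod cyc m)"
  proof -
    have "V * V = U \<circ>\<^sub>p xp (m + 1)"
      by (simp add: V_def pcompose_xp_xp d square_eq_pcompose flip: power2_eq_square)
    also have "[U \<circ>\<^sub>p xp (m + 1) = U \<circ>\<^sub>p xp 1] (mod cyc m)"
    proof (intro cong_pcompose xp_cong)
      show "[m + 1 = 1] (mod m)"
        unfolding cong_iff_lin_nat by (rule exI[of _ 1], rule exI[of _ 0]) simp
    qed
    also have "U \<circ>\<^sub>p xp 1 = U"
      using power_eq_pcompose[of U 0] by simp
    finally show ?thesis .
  qed
  have star_V: "[star m V = V] (mod cyc m)"
  proof -
    have "star m V = star m U \<circ>\<^sub>p xp d"
      by (simp add: V_def star_def pcompose_xp_xp mult.commute)
    also have "[star m U \<circ>\<^sub>p xp d = U \<circ>\<^sub>p xp d] (mod cyc m)"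
      by (intro cong_pcompose_xp[OF star_U]) simp
    finally show ?thesis
      by (simp add: V_def)
  qed
  have "[V * star m V * G = B] (mod cyc m)"
  proof -
    have "[V * star m V * G = V * V * G] (mod cyc m)"
      by (intro cong_scalar_left cong_scalar_right star_V)
    also have "[V * V * G = U * G] (mod cyc m)"
      by (intro cong_scalar_right V2)
    also have "U * G = B * (G * G')"
      by (simp add: U_def ac_simps)
    also have "[B * (G * G') = B * 1] (mod cyc m)"
      by (intro cong_scalar_left G')
    finally show ?thesis
      by simp
  qed
  then show thesis
    using that has_form_cong[OF has_form_act[OF m G]] by blast
qed

section \<open>Forms in degree a power of two\<close>

lemma trace_half_eq_0:
  assumes "x \<in> (fixed h :: 'a set)"
  shows "field_trace (2 * h) x = 0"
proof -
  have "allones (2 * h) = allones h * (xp h + 1)"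
    using allones_mult[of h 2] by (simp add: numeral_2_eq_2 mult.commute add.commute)
  then have "field_trace (2 * h) x = act (allones h) (act (xp h + 1) x)"
    by (simp add: trace_eq_act act_mult)
  also have "act (xp h + 1) x = 0"
    using assms by (simp add: act_add act_xp fixed_def double)
  finally show ?thesis
    by simp
qed

text \<open>The constant coefficient of \<open>G\<close> is the trace of \<open>x^2\<close>, equal
  to 1. The middle one is the trace of \<open>x * x ^ (2 ^ h)\<close>, which lies in
  \<open>fixed h\<close> and so has trace 0.\<close>

lemma hermitian_one_form:
  assumes h: "h > 0" and form: "has_form (2 * h) (x::'a) G" and trace: "field_trace (2 * h) x = 1"
  shows "hermitian_one (2 * h) G"
proof -
  let ?n = "2 * h"
  have n: "?n > 0"
    using h by simp
  have x: "x \<in> fixed ?n"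
    using form by (simp add: has_form_def)
  obtain c d W where G: "[G = [:c:] + monom d h + W + star ?n W] (mod cyc ?n)"
    using star_invariant_cong[OF h has_form_star[OF n form]] by blast
  have tau_W: "tau ?n W + tau ?n (star ?n W) = 0"
    by (simp add: tau_star[OF n] flip: mult_2)
  have tau_hW: "tau ?n (xp h * (W + star ?n W)) = 0"
  proof -
    have "[h * (?n - 1) = h] (mod ?n)"
      unfolding cong_iff_lin_nat
      by (rule exI[of _ "h - 1"], rule exI[of _ 0]) (use h in \<open>cases h, simp_all add: algebra_simps\<close>)
    then have "tau ?n (xp h * star ?n W) = tau ?n (star ?n (xp h * W))"
      unfolding star_mult star_xp by (intro tau_cong cong_scalar_right cong_sym[OF xp_cong])
    also have "\<dots> = tau ?n (xp h * W)"
      by (rule tau_star[OF n])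
    finally show ?thesis
      by (simp add: distrib_left tau_add flip: mult_2)
  qed
  have "\<not> ?n dvd h"
    using h by (auto dest: dvd_imp_le)
  then have tau_h: "tau ?n (xp h) = 0"
    by (simp add: tau_xp n)
  have tau_c: "tau ?n [:c:] = c"
    using tau_smult[of ?n c "xp 0"] tau_xp[OF n, of 0] by simp
  have tau_d: "tau ?n (monom d h) = 0"
    using tau_smult[of ?n d "xp h"] tau_h by (simp add: smult_monom)
  have tau_hc: "tau ?n (xp h * [:c:]) = 0"
    using tau_smult[of ?n c "xp h"] tau_h by simp
  have tau_hd: "tau ?n (xp h * monom d h) = d"
    using tau_smult[of ?n d "xp ?n"] n by (simp add: smult_monom mult_monom tau_xp flip: mult_2)
  have "gf2_embed (tau ?n G) = field_trace ?n (x * act 1 x)"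
    using form unfolding has_form_def by (metis mult_1)
  also have "x * act 1 x = x ^ (2 ^ 1)"
    by (simp add: power2_eq_square)
  also have "field_trace ?n (x ^ (2 ^ 1)) = 1"
    using trace_frobenius[OF x, of 1] trace by simp
  finally have "tau ?n G = 1"
    using gf2_cases[of "tau ?n G"] by auto
  moreover have "tau ?n G = c"
    unfolding tau_cong[OF G] tau_add add.assoc tau_c tau_d tau_W by simp
  moreover have "d = 0"
  proof -
    have "x ^ (2 ^ (h + h)) = x"
      using x by (simp add: fixed_def mult_2)
    then have "x * x ^ (2 ^ h) \<in> fixed h"
      by (simp add: fixed_def power_mult_distrib mult.commute power_add flip: power_mult)
    then have "field_trace ?n (x * act (xp h) x) = 0"
      using trace_half_eq_0 by (simp add: act_xp)
    then have "gf2_embed (tau ?n (xp h * G)) = (0::'a)"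
      using form by (simp add: has_form_def)
    then have "0 = tau ?n (xp h * G)"
      by (simp add: gf2_embed_eq_0_iff)
    also have "\<dots> = tau ?n (xp h * ([:c:] + monom d h + W + star ?n W))"
      by (intro tau_cong cong_scalar_left G)
    also have "\<dots> = d"
      using tau_hW by (simp only: distrib_left tau_add add.assoc tau_hc tau_hd add_0 add_0_right)
    finally show ?thesis ..
  qed
  ultimately show ?thesis
    using G by (auto simp: hermitian_one_def one_pCons)
qed

text \<open>The relative trace \<open>r\<close> of \<open>x\<close> to \<open>fixed 4\<close> has
  trace 1. If \<open>G\<close> were 1 modulo \<open>cyc 4\<close>, then \<open>r^3\<close> would
  have trace 0; but that trace is \<open>(r + r^4)^3\<close>, and \<open>r = r^4\<close> forces
  \<open>r\<close> to have trace 0.\<close>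

lemma form_not_cong_1:
  assumes n: "n = 4 * q" "n > 0"
    and form: "has_form n (x::'a) G" and trace: "field_trace n x = 1"
  shows "\<not> [G = 1] (mod cyc 4)"
proof
  assume G: "[G = 1] (mod cyc 4)"
  have x: "x \<in> fixed n"
    using form by (simp add: has_form_def)
  define Q where "Q = (\<Sum>j<q. xp (4 * j))"
  have Q: "cyc n = cyc 4 * Q" and ones: "allones n = allones 4 * Q"
    unfolding n Q_def by (rule cyc_mult, rule allones_mult)
  define r where "r = act Q x"
  have r: "r \<in> fixed 4"
    using x by (simp add: fixed_iff_act Q act_mult r_def)
  have trace_r: "field_trace 4 r = 1"
    using trace by (simp add: trace_eq_act ones act_mult r_def)
  \<comment> \<open>Transitivity of the trace: factors from \<open>fixed 4\<close> pass through the
    relative trace.\<close>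
  have "field_trace n (x * w) = field_trace 4 (r * w)" if w: "w \<in> fixed 4" for w
  proof -
    have "w ^ (2 ^ (4 * j)) = w" for j
      using frobenius_cong[OF w, of "4 * j" 0] by (simp add: cong_def)
    then have "act Q (x * w) = r * w"
      by (simp add: Q_def r_def act_sum act_xp power_mult_distrib sum_distrib_right)
    then show ?thesis
      by (simp add: trace_eq_act ones act_mult)
  qed
  from this[of "r ^ (2 ^ 1)"] have "field_trace 4 (r * r ^ (2 ^ 1)) = field_trace n (x * act (xp 1 * Q) x)"
    using frobenius_in_fixed[OF r, of 1] by (simp add: act_xp_mult r_def del: One_nat_def)
  also have "\<dots> = gf2_embed (tau n (xp 1 * Q * G))"
    using form by (simp add: has_form_def)
  also have "tau n (xp 1 * Q * G) = tau n (xp 1 * Q)"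
  proof (rule tau_cong)
    have "[xp 1 * (Q * G) = xp 1 * (Q * 1)] (mod cyc n)"
      unfolding Q mult.commute[of "cyc 4"] by (intro cong_scalar_left cong_cmult_leftI G)
    then show "[xp 1 * Q * G = xp 1 * Q] (mod cyc n)"
      by (simp add: mult.assoc del: One_nat_def)
  qed
  also have "tau n (xp 1 * Q) = (\<Sum>j<q. tau n (xp (1 + 4 * j)))"
    by (simp add: Q_def sum_distrib_left tau_sum mult_monom)
  also have "\<dots> = 0"
  proof (rule sum.neutral, rule ballI)
    fix j
    have "\<not> (4::nat) dvd 1 + 4 * j"
      by presburger
    \<comment> \<open>All exponents in \<open>xp 1 * Q\<close> are 1 modulo 4, so none is a multiple
      of \<open>n\<close>.\<close>
    then have "\<not> n dvd 1 + 4 * j"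
      unfolding n using dvd_mult_left by blast
    then show "tau n (xp (1 + 4 * j)) = 0"
      using n(2) by (simp add: tau_xp)
  qed
  finally have trace_r3: "field_trace 4 (r * r ^ 2) = 0"
    by simp
  have r16: "r ^ 16 = r"
    using r by (simp add: fixed_def)
  have "field_trace 4 y = y + y ^ 2 + y ^ 4 + y ^ 8" for y :: 'a
    by (simp add: field_trace_def numeral_eq_Suc)
  note tr = this
  have square: "(r + r ^ 4) ^ 2 = r ^ 2 + r ^ 8"
    using frobenius_add[of r "r ^ 4" 1] by (simp flip: power_mult)
  have "(r + r ^ 4) * (r + r ^ 4) ^ 2 = r * r ^ 2 + (r * r ^ 2) ^ 2 + (r * r ^ 2) ^ 4 + (r * r ^ 2) ^ 8"
  proof -
    have "(r * r ^ 2) ^ 8 = r ^ 16 * r ^ 8"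
      by (simp flip: power_add power_mult power_Suc)
    then show ?thesis
      unfolding r16 square by (simp add: algebra_simps flip: power_add power_mult power_Suc)
  qed
  then have "r + r ^ 4 = 0"
    using trace_r3 by (simp add: tr)
  moreover have "field_trace 4 r = (r + r ^ 4) + (r + r ^ 4) ^ 2"
    unfolding square by (simp add: tr algebra_simps)
  ultimately show False
    using trace_r by simp
qed

text \<open>The form \<open>G\<close> of an element of trace one has the same residue modulo
  \<open>cyc 4\<close> as \<open>A\<close>. The quotient \<open>A / G\<close> is therefore 1 there,
  hence a norm, and acting by its preimage turns \<open>G\<close> into \<open>A\<close>.\<close>

lemma even_form_exists:
  fixes s k :: nat
  defines "n \<equiv> 2 ^ (s + 2)"
  assumes N: "N = n * k"
    and A: "hermitian_one n A" "[A = 1 + xp 1 + xp 3] (mod cyc 4)"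
  obtains x :: 'a where "has_form n x A"
proof -
  have n: "n > 0" "n = 4 * 2 ^ s"
    by (simp_all add: n_def)
  obtain x :: 'a where x: "x \<in> fixed n" "field_trace n x = 1"
    using trace_one[OF N n(1)] by blast
  obtain G where form: "has_form n x G"
    using form_exists[OF x(1) n(1)] by blast
  have herm: "hermitian_one n G"
    using hermitian_one_form[of "2 ^ (s + 1)" x G] form x(2) by (simp add: n_def)
  have G4: "[G = 1 + xp 1 + xp 3] (mod cyc 4)"
    by (rule hermitian_one_cong_4[OF herm _ n(1) form_not_cong_1[OF n(2,1) form x(2)]]) (simp add: n(2))
  have power_n: "[f ^ n = 1] (mod cyc n)" if "poly f 1 = 1" for f
    using power_cong_poly_1[of f "s + 2"] that by (simp add: n_def one_pCons)
  have Suc_n: "f * f ^ (n - 1) = f ^ n" for f :: "gf2 poly"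
    using n(1) by (simp flip: power_Suc)
  \<comment> \<open>Since \<open>G ^ n\<close> is 1 modulo \<open>cyc n\<close>, this is the
    quotient of \<open>A\<close> by \<open>G\<close>.\<close>
  define U where "U = A * G ^ (n - 1)"
  have "hermitian_one n U"
    unfolding U_def by (intro hermitian_one_mult hermitian_one_power n A herm)
  moreover have "[U = 1] (mod cyc 4)"
  proof -
    let ?P = "1 + xp 1 + xp 3"
    have "[U = ?P * ?P ^ (n - 1)] (mod cyc 4)"
      unfolding U_def by (intro cong_mult cong_pow A G4)
    also have "?P * ?P ^ (n - 1) = ?P ^ n"
      by (rule Suc_n)
    also have "[?P ^ n = 1] (mod cyc 4)"
      by (rule cong_dvd_modulus[OF power_n cyc_dvd]) (simp_all add: poly_monom n(2))
    finally show ?thesis .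
  qed
  ultimately obtain f where f: "[f * star n f = U] (mod cyc n)"
    using norm_surj unfolding n_def by blast
  have "[f * star n f * G = U * G] (mod cyc n)"
    by (intro cong_scalar_right f)
  also have "U * G = A * (G * G ^ (n - 1))"
    by (simp add: U_def ac_simps)
  also have "G * G ^ (n - 1) = G ^ n"
    by (rule Suc_n)
  also have "[A * G ^ n = A * 1] (mod cyc n)"
    by (intro cong_scalar_left power_n hermitian_one_poly_1[OF herm])
  finally show thesis
    using that[OF has_form_cong[OF has_form_act[OF n(1) form]]] by simp
qed

end

theorem proposition5p4:
  fixes m s :: nat and a b :: "nat \<Rightarrow> gf2"
  assumes "odd m"
    and "(2::nat) ^ s \<ge> 4"
    and "symmetric_vector (2 ^ s) a"
    and "a 0 = 1"
    and "a (2 ^ (s - 1)) = 0"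
    and "(\<Sum>i | i \<le> 2 ^ (s - 1) - 1 \<and> odd i. a i) = 1"
    and "symmetric_vector m b"
    and "gcd (\<Sum>i<m. monom (b i) i) (monom 1 m - 1) = 1"
    and "CARD('a::{field,finite}) = 2 ^ (2 ^ s * m)"
  shows "\<exists>(\<alpha>::'a) c. normal_element (2 ^ s * m) \<alpha> \<and>
           corresponding_vector (2 ^ s * m) \<alpha> c \<and>
           (\<forall>k < 2 ^ s * m. c k = a (k mod 2 ^ s) * b (k mod m))"
proof -
  have m: "m > 0"
    using assms(1) by (cases m) auto
  interpret gf2_extension "2 ^ s * m" "TYPE('a)"
    by unfold_locales (use assms(9) m in simp_all)
  have "s \<ge> 2"
  proof (rule ccontr)
    assume "\<not> s \<ge> 2"
    then have "s = 0 \<or> s = 1" by linarith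
    then show False using assms(2) by auto
  qed
  then obtain t where t: "s = t + 2"
    by (metis add.commute le_Suc_ex)
  define n where "n = (2::nat) ^ s"
  define h where "h = (2::nat) ^ (t + 1)"
  have n: "n > 0" "n = 2 * h" "n = 2 ^ (t + 2)" and h: "h > 0" "even h" "h = 2 ^ (s - 1)"
    by (simp_all add: n_def h_def t)
  define A where "A = (\<Sum>k<n. monom (a k) k)"
  define B where "B = (\<Sum>k<m. monom (b k) k)"
  have sym: "symmetric_vector n a"
    using assms(3) by (simp add: n_def)
  have herm: "hermitian_one n A"
    using hermitian_one_symmetric_vector[of h a] sym assms(4,5) h by (simp add: A_def n(2))
  \<comment> \<open>Odd indices are positive and \<open>h > 0\<close>, so the two ranges
    agree.\<close>
  have "(\<Sum>i\<in>{0<..<h}. if odd i then a i else 0) = (\<Sum>i | i \<le> h - 1 \<and> odd i. a i)"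
    by (rule sum.mono_neutral_cong_right) (use h(1) in \<open>auto intro: Nat.gr0I\<close>)
  then have A4: "[A = 1 + xp 1 + xp 3] (mod cyc 4)"
    using symmetric_vector_cong_4[of h a] sym assms(4-6) h by (simp add: A_def n(2))
  obtain u :: 'a where u: "has_form n u A"
    using even_form_exists[of t m A] herm A4 n(3) n_def by metis
  \<comment> \<open>\<open>A\<close> is a unit because its value at 1 is 1 and the group order is a
    power of two.\<close>
  have "[A * A ^ (n - 1) = 1] (mod cyc n)"
    using power_cong_poly_1[of A s] hermitian_one_poly_1[OF herm] n(1)
    by (simp add: n_def one_pCons flip: power_Suc)
  obtain v :: 'a where v: "has_form m v B"
    using odd_form_exists[of m n B] symmetric_vector_star[OF assms(7) m] assms(1)
    by (auto simp: n_def B_def)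
  obtain B' where B': "[B * B' = 1] (mod cyc m)"
    using coprime_invertible[of B "cyc m"] assms(8) by (auto simp: B_def cyc_def)
  have coprime: "coprime n m"
    using assms(1) by (simp add: n_def)
  have "generator (n * m) (u * v)"
    using generator_mult_coprime[OF coprime n(1) m u \<open>[A * A ^ (n - 1) = 1] (mod cyc n)\<close> v B'] .
  then have normal: "normal_element (n * m) (u * v)"
    unfolding n_def by (rule generator_imp_normal)
  have uv: "u \<in> fixed n" "v \<in> fixed m"
    using u v by (simp_all add: has_form_def)
  have "gf2_embed (a (k mod n) * b (k mod m)) = field_trace (n * m) (u * v * (u * v) ^ (2 ^ k))" for k
  proof -
    have "u * v * (u * v) ^ (2 ^ k) = (u * u ^ (2 ^ k)) * (v * v ^ (2 ^ k))"
      by (simp add: power_mult_distrib)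
    also have "field_trace (n * m) \<dots> = field_trace n (u * u ^ (2 ^ k)) * field_trace m (v * v ^ (2 ^ k))"
      by (intro trace_mult_coprime coprime n m mult_in_fixed frobenius_in_fixed uv)
    also have "\<dots> = gf2_embed (a (k mod n)) * gf2_embed (b (k mod m))"
      using trace_symmetric_vector[OF sym n(1)] trace_symmetric_vector[OF assms(7) m] u v
      by (simp add: A_def B_def)
    finally show ?thesis
      by (simp add: gf2_embed_mult)
  qed
  then have "corresponding_vector (n * m) (u * v) (\<lambda>k. a (k mod n) * b (k mod m))"
    by (simp add: corresponding_vector_def)
  with normal show ?thesis
    unfolding n_def by blast
qed

end
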